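(* Let $U\in C^2(\mathbb{R}^d,\mathbb{R})$ with $U\ge0$ and $\int_{\mathbb{R}^d}\exp(-U(q))\,dq<\infty$, let $\lambda_{\mathrm{ref}}>0$ and $0<\alpha\le1$. Assume that the force $\nabla U$ is Lipschitz continuous and that $\lim_{\|q\|\to\infty}U(q)=\infty$. Then the Randomized Hamiltonian Monte Carlo (RHMC) process with potential $U$, refreshment rate $\lambda_{\mathrm{ref}}$ and parameter $\alpha$ is Feller, and $C_c^\infty(\mathbb{R}^{2d})$ is a core of its generator.
   Context: RHMC process: the Markov process $Z_t$ on $\mathbb{R}^{2d}=\mathbb{R}^d\times\mathbb{R}^d\ni z=(q,p)$ which follows the flow $\varphi_t$ of the ODE $\dot z=g(z)$, $g(q,p)=(p,-\nabla U(q))$, between jumps; the waiting times between successive jumps are independent $\mathrm{Exp}(\lambda_{\mathrm{ref}})$-distributed (i.e. constant jump intensity $\lambda\equiv\lambda_{\mathrm{ref}}$); at each jump the state $(q,p)$ is replaced by $R^\xi(q,p)=(q,\alpha p+\sqrt{1-\alpha^2}\,\xi)$ with a fresh $\xi\sim\mathcal{N}(0,I_d)$ independent of everything else. Its Markov semigroup is $P_tf(z)=\mathbb{E}_z[f(Z_t)]$. $C_0(\mathbb{R}^{2d})$ is the space of continuous real functions vanishing at infinity, with supremum norm $\|\cdot\|_\infty$; $C_c^\infty(\mathbb{R}^{2d})$ is the space of infinitely differentiable functions with compact support. The process is Feller if $P_tf\in C_0(\mathbb{R}^{2d})$ for all $t\ge0$, $f\in C_0(\mathbb{R}^{2d})$,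 and $\lim_{t\to0}\|P_tf-f\|_\infty=0$ for all $f\in C_0(\mathbb{R}^{2d})$. The generator is $\mathcal{L}f=\lim_{t\downarrow0}\frac1t(P_tf-f)$ (limit in $\|\cdot\|_\infty$), with domain $\mathrm{dom}(\mathcal{L})$ the set of $f\in C_0(\mathbb{R}^{2d})$ for which the limit exists. A core of $\mathcal{L}$ is a subset $E\subset\mathrm{dom}(\mathcal{L})$ such that for every $f\in\mathrm{dom}(\mathcal{L})$ there is a sequence $f_n\in E$ with $\|f_n-f\|_\infty\to0$ and $\|\mathcal{L}f_n-\mathcal{L}f\|_\infty\to0$. *)

theory Defs
  imports "HOL-Probability.Probability"
begin

text \<open>For \<open>k \<ge> 1\<close> this is: Frechet differentiable everywhere, with all directional derivatives
  \<open>x \<mapsto> Df(x) v\<close> of class \<open>C\<^sup>k\<^sup>-\<^sup>1\<close>. In finite dimension this is the usual \<open>C\<^sup>k\<close>.\<close>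

primrec C_k :: "nat \<Rightarrow> ('a::euclidean_space \<Rightarrow> real) \<Rightarrow> bool" where
  "C_k 0 f \<longleftrightarrow> continuous_on UNIV f"
| "C_k (Suc k) f \<longleftrightarrow>
     (\<forall>x. f differentiable (at x)) \<and> (\<forall>v. C_k k (\<lambda>x. frechet_derivative f (at x) v))"

definition Cc_infty :: "('a::euclidean_space \<Rightarrow> real) set" where
  "Cc_infty = {f. (\<forall>k. C_k k f) \<and> compact (closure {x. f x \<noteq> 0})}"

definition C_0 :: "('a::euclidean_space \<Rightarrow> real) set" where
  "C_0 = {f. continuous_on UNIV f \<and> (f \<longlongrightarrow> 0) at_infinity}"

text \<open>Only meaningful for bounded \<open>f\<close>; below it is applied to differences of \<open>C_0\<close> functions
  (for the terms \<open>P t f\<close> this membership is the first clause of \<open>feller\<close>).\<close>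

definition sup_norm :: "('a \<Rightarrow> real) \<Rightarrow> real" where
  "sup_norm f = (SUP x. \<bar>f x\<bar>)"

definition feller :: "(real \<Rightarrow> ('a::euclidean_space \<Rightarrow> real) \<Rightarrow> 'a \<Rightarrow> real) \<Rightarrow> bool" where
  "feller P \<longleftrightarrow>
     (\<forall>t\<ge>0. \<forall>f\<in>C_0. P t f \<in> C_0) \<and>
     (\<forall>f\<in>C_0. ((\<lambda>t. sup_norm (\<lambda>z. P t f z - f z)) \<longlongrightarrow> 0) (at_right 0))"

definition is_generator_limit ::
  "(real \<Rightarrow> ('a::euclidean_space \<Rightarrow> real) \<Rightarrow> 'a \<Rightarrow> real) \<Rightarrow> ('a \<Rightarrow> real) \<Rightarrow> ('a \<Rightarrow> real) \<Rightarrow> bool" where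
  "is_generator_limit P f h \<longleftrightarrow>
     h \<in> C_0 \<and> ((\<lambda>t. sup_norm (\<lambda>z. (1 / t) * (P t f z - f z) - h z)) \<longlongrightarrow> 0) (at_right 0)"

definition generator_dom ::
  "(real \<Rightarrow> ('a::euclidean_space \<Rightarrow> real) \<Rightarrow> 'a \<Rightarrow> real) \<Rightarrow> ('a \<Rightarrow> real) set" where
  "generator_dom P = {f \<in> C_0. \<exists>h. is_generator_limit P f h}"

definition generator ::
  "(real \<Rightarrow> ('a::euclidean_space \<Rightarrow> real) \<Rightarrow> 'a \<Rightarrow> real) \<Rightarrow> ('a \<Rightarrow> real) \<Rightarrow> 'a \<Rightarrow> real" where
  "generator P f = (THE h. is_generator_limit P f h)"

definition is_core_of_generator ::
  "('a::euclidean_space \<Rightarrow> real) set \<Rightarrow> (real \<Rightarrow> ('a \<Rightarrow> real) \<Rightarrow> 'a \<Rightarrow> real) \<Rightarrow> bool" where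
  "is_core_of_generator E P \<longleftrightarrow>
     E \<subseteq> generator_dom P \<and>
     (\<forall>f\<in>generator_dom P. \<exists>F :: nat \<Rightarrow> 'a \<Rightarrow> real. (\<forall>n. F n \<in> E) \<and>
        (\<lambda>n. sup_norm (\<lambda>z. F n z - f z)) \<longlonglongrightarrow> 0 \<and>
        (\<lambda>n. sup_norm (\<lambda>z. generator P (F n) z - generator P f z)) \<longlonglongrightarrow> 0)"

definition grad :: "('a::euclidean_space \<Rightarrow> real) \<Rightarrow> 'a \<Rightarrow> 'a" where
  "grad U q = (THE D. GDERIV U q :> D)"

definition ham_field :: "('a::euclidean_space \<Rightarrow> real) \<Rightarrow> 'a \<times> 'a \<Rightarrow> 'a \<times> 'a" where
  "ham_field U = (\<lambda>(q, p). (p, - grad U q))"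

text \<open>The description is proper when \<open>grad U\<close> is Lipschitz (global existence and uniqueness).\<close>

definition ham_flow :: "('a::euclidean_space \<Rightarrow> real) \<Rightarrow> real \<Rightarrow> 'a \<times> 'a \<Rightarrow> 'a \<times> 'a" where
  "ham_flow U t z =
     (THE x. x 0 = z \<and> (\<forall>s. (x has_vector_derivative ham_field U (x s)) (at s))) t"

definition refresh :: "real \<Rightarrow> 'a::euclidean_space \<Rightarrow> 'a \<times> 'a \<Rightarrow> 'a \<times> 'a" where
  "refresh \<alpha> \<xi> = (\<lambda>(q, p). (q, \<alpha> *\<^sub>R p + sqrt (1 - \<alpha>\<^sup>2) *\<^sub>R \<xi>))"

definition std_gaussian :: "'a::euclidean_space measure" where
  "std_gaussian = density lborel (\<lambda>x. ennreal (\<Prod>b\<in>Basis. std_normal_density (x \<bullet> b)))"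

text \<open>Canonical sample space of the noise: \<open>\<omega> n\<close> is the pair of the \<open>n\<close>-th waiting time and the
  \<open>n\<close>-th refreshment variable, all independent.\<close>

definition rhmc_noise :: "real \<Rightarrow> (nat \<Rightarrow> real \<times> 'a::euclidean_space) measure" where
  "rhmc_noise r =
     (\<Pi>\<^sub>M n\<in>UNIV. density lborel (exponential_density r) \<Otimes>\<^sub>M std_gaussian)"

definition jump_time :: "(nat \<Rightarrow> real \<times> 'a) \<Rightarrow> nat \<Rightarrow> real" where
  "jump_time \<omega> n = (\<Sum>k<n. fst (\<omega> k))"

primrec post_jump_state ::
  "('a::euclidean_space \<Rightarrow> real) \<Rightarrow> real \<Rightarrow> (nat \<Rightarrow> real \<times> 'a) \<Rightarrow> 'a \<times> 'a \<Rightarrow> nat \<Rightarrow> 'a \<times> 'a" where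
  "post_jump_state U \<alpha> \<omega> z 0 = z"
| "post_jump_state U \<alpha> \<omega> z (Suc n) =
     refresh \<alpha> (snd (\<omega> n)) (ham_flow U (fst (\<omega> n)) (post_jump_state U \<alpha> \<omega> z n))"

text \<open>The \<open>n\<close>-th jump occurs at \<open>jump_time \<omega> n\<close> for \<open>n \<ge> 1\<close>, and \<open>jump_time \<omega> 0 = 0\<close>.\<close>

definition num_jumps :: "(nat \<Rightarrow> real \<times> 'a) \<Rightarrow> real \<Rightarrow> nat" where
  "num_jumps \<omega> t = (LEAST n. t < jump_time \<omega> (Suc n))"

definition rhmc_process ::
  "('a::euclidean_space \<Rightarrow> real) \<Rightarrow> real \<Rightarrow> 'a \<times> 'a \<Rightarrow> real \<Rightarrow> (nat \<Rightarrow> real \<times> 'a) \<Rightarrow> 'a \<times> 'a" where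
  "rhmc_process U \<alpha> z t \<omega> =
     (let n = num_jumps \<omega> t in
      ham_flow U (t - jump_time \<omega> n) (post_jump_state U \<alpha> \<omega> z n))"

definition rhmc_semigroup ::
  "('a::euclidean_space \<Rightarrow> real) \<Rightarrow> real \<Rightarrow> real \<Rightarrow> real \<Rightarrow> ('a \<times> 'a \<Rightarrow> real) \<Rightarrow> 'a \<times> 'a \<Rightarrow> real" where
  "rhmc_semigroup U r \<alpha> t f z = (\<integral>\<omega>. f (rhmc_process U \<alpha> z t \<omega>) \<partial>rhmc_noise r)"

end

theory Submission
  imports Defs
begin

text \<open>
  Write \<open>\<phi>\<close> for the Hamiltonian flow, \<open>A f = D f \<cdot> g\<close> for the derivative along it, and \<open>Q\<close> for the
  average over a refreshment (\<open>jump_op\<close>).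

  \<^emph>\<open>Feller property.\<close> For a fixed path of the noise the state at time \<open>t\<close> is a composition of flow maps
  and refreshments, hence a continuous map of the initial point that sends infinity to infinity.
  Dominated convergence turns this into \<open>P_t f \<in> C_0\<close>. Strong continuity follows from that of
  \<open>f \<mapsto> f \<circ> \<phi>_t\<close>, because a jump before time \<open>t\<close> has probability \<open>O(t)\<close>.

  \<^emph>\<open>Generator on test functions.\<close> Two jumps before time \<open>t\<close> have probability \<open>O(t\<^sup>2)\<close>. Expanding
  in the number of jumps (\<open>one_jump_expansion\<close>) shows that a test function \<open>f\<close> lies in the domain,
  with generator \<open>A f + r (Q f - f)\<close>, where \<open>r\<close> is the refreshment rate.

  \<^emph>\<open>Core.\<close> Each \<open>P_t\<close> is a contraction, so the generator is dissipative, and it is enough that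
  \<open>\<mu> F - A F - r (Q F - F)\<close> with test functions \<open>F\<close> comes arbitrarily close to every \<open>h \<in> C_0\<close>
  (\<open>core_if_dense_range\<close>). As \<open>Q\<close> is a contraction too, it suffices to solve \<open>\<nu> F - A F = h\<close>
  approximately with \<open>\<nu> = \<mu> + r\<close>: the term \<open>r Q F\<close> left over is smaller than \<open>h\<close> by a factor close
  to \<open>r / \<nu> < 1\<close>, and the procedure can be repeated with the residual.

  \<^emph>\<open>The flow equation\<close> (\<open>resolvent_equation_approx\<close>). For a test function \<open>h\<close> the function
  \<open>f z = \<integral> exp (- \<nu> t) h (\<phi>_t z) dt\<close> solves \<open>\<nu> f - A f = h\<close>. Conservation of energy gives it bounded
  support, and it is Lipschitz when \<open>\<nu>\<close> exceeds the Lipschitz constant \<open>L\<close> of the vector field.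
  Mollifying \<open>f\<close> at scale \<open>\<epsilon>\<close> yields a test function. The commutator of mollification and \<open>A\<close> is
  \<open>O(\<epsilon>)\<close>: for \<open>\<bar>y\<bar> \<le> \<epsilon>\<close> the points \<open>\<phi>_t z - y\<close> and \<open>\<phi>_t (z - y)\<close> differ by at most
  \<open>(exp (L t) - 1) \<epsilon>\<close>, and \<open>f\<close> is Lipschitz.
\<close>

section \<open>Smooth functions and functions vanishing at infinity\<close>

lemma C_k_SucI:
  assumes "\<And>x. (f has_derivative f' x) (at x)" "\<And>v. C_k k (\<lambda>x. f' x v)"
  shows "C_k (Suc k) f"
proof -
  have "frechet_derivative f (at x) = f' x" for x
    using frechet_derivative_at[OF assms(1)] by simp
  then show ?thesis using assms by (auto simp: differentiable_def)
qed

lemma C_k_SucD: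
  assumes "C_k (Suc k) f"
  shows "(f has_derivative frechet_derivative f (at x)) (at x)"
    and "C_k k (\<lambda>x. frechet_derivative f (at x) v)"
  using assms by (auto simp: frechet_derivative_works[symmetric])

lemma C_k_continuous: "C_k k f \<Longrightarrow> continuous_on UNIV f"
  by (cases k) (auto simp: differentiable_on_def
      intro!: differentiable_imp_continuous_on)

text \<open>A class of functions closed under directional derivatives consists of smooth functions; this
  gives all orders at once without computing a single iterated derivative.\<close>

lemma C_k_closed_class:
  assumes "f \<in> S"
    and "\<And>f. f \<in> S \<Longrightarrow> \<exists>f'. (\<forall>x. (f has_derivative f' x) (at x)) \<and> (\<forall>v. (\<lambda>x. f' x v) \<in> S)"
  shows "C_k k f"
  using assms(1)
proof (induction k arbitrary: f)
  case 0
  then show ?case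
    using assms(2) by (metis C_k.simps(1) continuous_at_imp_continuous_on has_derivative_continuous)
next
  case (Suc k)
  then show ?case using assms(2)[OF Suc.prems] by (metis C_k_SucI)
qed

lemma C_k_add: "C_k k f \<Longrightarrow> C_k k h \<Longrightarrow> C_k k (\<lambda>x. f x + h x)"
proof (induction k arbitrary: f h)
  case (Suc k)
  show ?case
    by (rule C_k_SucI[OF has_derivative_add[OF C_k_SucD(1)[OF Suc.prems(1)] C_k_SucD(1)[OF Suc.prems(2)]]])
      (intro Suc.IH C_k_SucD(2) Suc.prems)
qed (auto intro: continuous_intros)

lemma C_k_scale: "C_k k f \<Longrightarrow> C_k k (\<lambda>x. c * f x)"
proof (induction k arbitrary: f)
  case (Suc k)
  show ?case
    by (rule C_k_SucI[OF has_derivative_mult_right[OF C_k_SucD(1)[OF Suc.prems]]])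
      (intro Suc.IH C_k_SucD(2) Suc.prems)
qed (auto intro: continuous_intros)

lemma C_0_I:
  assumes "continuous_on UNIV f" "\<And>z. norm z > R \<Longrightarrow> f z = 0"
  shows "f \<in> C_0"
proof -
  have "eventually (\<lambda>z. f z = 0) at_infinity"
    using assms(2) by (auto simp: eventually_at_infinity intro!: exI[of _ "R + 1"])
  then show ?thesis using assms(1) by (auto simp: C_0_def intro: tendsto_eventually)
qed

lemma C_0_small_outside:
  assumes "f \<in> C_0" "e > 0"
  obtains R where "\<And>z. norm z > R \<Longrightarrow> \<bar>f z\<bar> < e"
proof -
  have "eventually (\<lambda>z. \<bar>f z\<bar> < e) at_infinity"
    using assms tendstoD[of f 0 at_infinity e] by (simp add: C_0_def)
  then show ?thesis using that by (auto simp: eventually_at_infinity) (meson less_imp_le)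
qed

lemma C_0_uniformly_continuous:
  assumes f: "f \<in> C_0" and "e > 0"
  obtains d where "d > 0" "\<And>x y. norm (x - y) < d \<Longrightarrow> \<bar>f x - f y\<bar> \<le> e"
proof -
  obtain R where R: "\<And>z. norm z > R \<Longrightarrow> \<bar>f z\<bar> < e / 2"
    using C_0_small_outside[OF f, of "e / 2"] \<open>e > 0\<close> by auto
  have "uniformly_continuous_on (cball 0 (R + 1)) f"
    using f by (intro compact_uniformly_continuous) (auto simp: C_0_def intro: continuous_on_subset)
  then obtain d where d: "d > 0" "\<And>x y. x \<in> cball 0 (R + 1) \<Longrightarrow> y \<in> cball 0 (R + 1) \<Longrightarrow>
      dist y x < d \<Longrightarrow> dist (f y) (f x) < e"
    using \<open>e > 0\<close> unfolding uniformly_continuous_on_def by metis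
  have "\<bar>f x - f y\<bar> \<le> e" if "norm (x - y) < min d 1" for x y
  proof (cases "norm x \<le> R + 1 \<and> norm y \<le> R + 1")
    case True
    then show ?thesis using d(2)[of y x] that by (simp add: dist_norm)
  next
    case False
    then have "norm x > R" "norm y > R"
      using that norm_triangle_ineq2[of x y] norm_triangle_ineq3[of x y] by linarith+
    then show ?thesis using R[of x] R[of y] by linarith
  qed
  then show ?thesis using that[of "min d 1"] d(1) by auto
qed

lemma C_0_bounded:
  assumes "f \<in> C_0"
  obtains B where "B > 0" "\<And>z. \<bar>f z\<bar> \<le> B"
proof -
  obtain R where R: "\<And>z. norm z > R \<Longrightarrow> \<bar>f z\<bar> < 1"
    using C_0_small_outside[OF assms, of 1] by auto
  have "compact (f ` cball 0 R)"
    using assms by (intro compact_continuous_image) (auto simp: C_0_def intro: continuous_on_subset)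
  then obtain B where "\<And>z. norm z \<le> R \<Longrightarrow> \<bar>f z\<bar> \<le> B"
    by (force dest!: compact_imp_bounded simp: bounded_iff)
  then have "\<bar>f z\<bar> \<le> max 1 B" for z using R[of z] by (cases "norm z \<le> R") (auto simp: le_max_iff_disj)
  then show ?thesis using that[of "max 1 B"] by auto
qed

lemma C_0_add: "f \<in> C_0 \<Longrightarrow> h \<in> C_0 \<Longrightarrow> (\<lambda>z. f z + h z) \<in> C_0"
  by (auto simp: C_0_def intro!: continuous_intros tendsto_eq_intros)

lemma C_0_diff: "f \<in> C_0 \<Longrightarrow> h \<in> C_0 \<Longrightarrow> (\<lambda>z. f z - h z) \<in> C_0"
  by (auto simp: C_0_def intro!: continuous_intros tendsto_eq_intros)

lemma C_0_scale: "f \<in> C_0 \<Longrightarrow> (\<lambda>z. c * f z) \<in> C_0"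
  by (auto simp: C_0_def intro!: continuous_intros tendsto_eq_intros)

lemma Cc_infty_I:
  assumes "\<And>k. C_k k f" "\<And>z. norm z > R \<Longrightarrow> f z = 0"
  shows "f \<in> Cc_infty"
proof -
  have "{z. f z \<noteq> 0} \<subseteq> cball 0 R" using assms(2) by force
  then have "bounded {z. f z \<noteq> 0}" by (rule bounded_subset[rotated]) simp
  then show ?thesis using assms(1) by (auto simp: Cc_infty_def compact_closure)
qed

lemma Cc_infty_vanishes:
  assumes "f \<in> Cc_infty"
  obtains R where "\<And>z. norm z > R \<Longrightarrow> f z = 0"
proof -
  have "bounded {z. f z \<noteq> 0}" using assms by (auto simp: Cc_infty_def compact_closure)
  then show ?thesis using that unfolding bounded_iff by (metis mem_Collect_eq not_le)
qed

lemma Cc_infty_in_C_0: "f \<in> Cc_infty \<Longrightarrow> f \<in> C_0"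
  using Cc_infty_vanishes[of f] C_k_continuous by (metis (no_types, lifting) C_0_I Cc_infty_def mem_Collect_eq)

lemma Cc_infty_add: "f \<in> Cc_infty \<Longrightarrow> h \<in> Cc_infty \<Longrightarrow> (\<lambda>z. f z + h z) \<in> Cc_infty"
proof -
  assume *: "f \<in> Cc_infty" "h \<in> Cc_infty"
  obtain R S where "\<And>z. norm z > R \<Longrightarrow> f z = 0" "\<And>z. norm z > S \<Longrightarrow> h z = 0"
    using *[THEN Cc_infty_vanishes] by metis
  then show ?thesis
    using * by (intro Cc_infty_I[of _ "max R S"]) (auto simp: Cc_infty_def intro: C_k_add)
qed

lemma Cc_infty_derivative:
  assumes "f \<in> Cc_infty"
  shows "(f has_derivative frechet_derivative f (at z)) (at z)"
  using assms C_k_SucD(1)[of 0 f] by (simp add: Cc_infty_def del: C_k.simps)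

lemma frechet_derivative_sum_Basis:
  assumes "(f has_derivative frechet_derivative f (at z)) (at z)"
  shows "frechet_derivative f (at z) v = (\<Sum>b\<in>Basis. (v \<bullet> b) * frechet_derivative f (at z) b)"
proof -
  have l: "linear (frechet_derivative f (at z))"
    using assms has_derivative_linear by blast
  have "frechet_derivative f (at z) v = frechet_derivative f (at z) (\<Sum>b\<in>Basis. (v \<bullet> b) *\<^sub>R b)"
    by (simp add: euclidean_representation)
  also have "\<dots> = (\<Sum>b\<in>Basis. (v \<bullet> b) * frechet_derivative f (at z) b)"
    using l by (simp add: linear_sum linear_cmul)
  finally show ?thesis .
qed

definition lie_derivative :: "('b::euclidean_space \<Rightarrow> 'b) \<Rightarrow> ('b \<Rightarrow> real) \<Rightarrow> 'b \<Rightarrow> real" where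
  "lie_derivative g f z = frechet_derivative f (at z) (g z)"

lemma lie_derivative_C_0:
  assumes f: "f \<in> Cc_infty" and g: "continuous_on UNIV g"
  shows "lie_derivative g f \<in> C_0"
proof -
  note d = Cc_infty_derivative[OF f]
  obtain R where R: "\<And>z. norm z > R \<Longrightarrow> f z = 0"
    using Cc_infty_vanishes[OF f] by blast
  have "continuous_on UNIV (\<lambda>z. frechet_derivative f (at z) b)" for b
    using C_k_continuous[OF C_k_SucD(2)[of 0 f]] f by (simp add: Cc_infty_def del: C_k.simps)
  moreover have "lie_derivative g f = (\<lambda>z. \<Sum>b\<in>Basis. (g z \<bullet> b) * frechet_derivative f (at z) b)"
    unfolding lie_derivative_def by (intro ext frechet_derivative_sum_Basis[OF d])
  ultimately have "continuous_on UNIV (lie_derivative g f)"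
    using g by (auto intro!: continuous_intros)
  moreover have "lie_derivative g f z = 0" if "norm z > R" for z
  proof -
    have "open {z::'a. norm z > R}" by (intro open_Collect_less continuous_intros)
    then have "((\<lambda>_. 0) has_derivative frechet_derivative f (at z)) (at z)"
      by (rule has_derivative_transform_within_open[OF d]) (use that R in auto)
    then have "frechet_derivative f (at z) = (\<lambda>_. 0)"
      by (rule has_derivative_unique) (rule has_derivative_const)
    then show ?thesis by (simp add: lie_derivative_def)
  qed
  ultimately show ?thesis by (rule C_0_I)
qed

lemma lie_derivative_add:
  assumes "f \<in> Cc_infty" "h \<in> Cc_infty"
  shows "lie_derivative g (\<lambda>z. f z + h z) z = lie_derivative g f z + lie_derivative g h z"
  using frechet_derivative_at[OF has_derivative_add[OF assms[THEN Cc_infty_derivative]], of z]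
  by (simp add: lie_derivative_def fun_eq_iff)

lemma Cc_infty_lipschitz:
  assumes "f \<in> Cc_infty"
  obtains M where "M > 0" "\<And>x y. \<bar>f x - f y\<bar> \<le> M * norm (x - y)"
proof -
  have "\<forall>b. \<exists>B>0. \<forall>z. \<bar>frechet_derivative f (at z) b\<bar> \<le> B"
    using C_0_bounded[OF lie_derivative_C_0[OF assms continuous_on_const]]
    by (metis lie_derivative_def)
  then obtain B where B: "\<And>b. B b > 0" "\<And>b z. \<bar>frechet_derivative f (at z) b\<bar> \<le> B b"
    by metis
  define M where "M = (\<Sum>b\<in>Basis. B b)"
  have "M > 0" unfolding M_def by (rule sum_pos) (auto simp: B)
  have "onorm (frechet_derivative f (at z)) \<le> M" for z
  proof (rule onorm_bound)
    fix v
    have "norm (frechet_derivative f (at z) v) \<le> (\<Sum>b\<in>Basis. \<bar>v \<bullet> b\<bar> * \<bar>frechet_derivative f (at z) b\<bar>)"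
      unfolding frechet_derivative_sum_Basis[OF Cc_infty_derivative[OF assms], of z v]
      by (auto simp: abs_mult[symmetric] intro: sum_abs)
    also have "\<dots> \<le> (\<Sum>b\<in>Basis. norm v * B b)"
      by (intro sum_mono mult_mono B Basis_le_norm) auto
    finally show "norm (frechet_derivative f (at z) v) \<le> M * norm v"
      by (simp add: M_def sum_distrib_left mult.commute)
  qed (use \<open>M > 0\<close> in simp)
  then have "\<bar>f x - f y\<bar> \<le> M * norm (x - y)" for x y
    using differentiable_bound[OF convex_UNIV, of f "\<lambda>z. frechet_derivative f (at z)" M]
      Cc_infty_derivative[OF assms] by simp
  with \<open>M > 0\<close> show ?thesis by (rule that)
qed

section \<open>Mollification\<close>

text \<open>The factors \<open>1 / x ^ n\<close> are those that differentiating \<open>exp (- 1 / x)\<close> produces, so that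
  the span of these functions is closed under differentiation.\<close>

definition flat :: "nat \<Rightarrow> real \<Rightarrow> real" where
  "flat n x = (if x \<le> 0 then 0 else exp (- 1 / x) / x ^ n)"

text \<open>One term of the exponential series bounds \<open>exp (1 / x)\<close> below by \<open>x ^ - (n + 2) / (n + 2)!\<close>.
  A bound by \<open>x\<^sup>2\<close> is what makes the derivative at \<open>0\<close> exist and vanish.\<close>

lemma flat_le_square: "\<bar>flat n x\<bar> \<le> fact (n + 2) * x\<^sup>2"
proof (cases "x \<le> 0")
  case False
  have "(1 / x) ^ (n + 2) / fact (n + 2) \<le> exp (1 / x)"
  proof -
    have s: "(\<lambda>k. (1 / x) ^ k /\<^sub>R fact k) sums exp (1 / x)" by (rule exp_converges)
    have "sum (\<lambda>k. (1 / x) ^ k /\<^sub>R fact k) {n + 2} \<le> exp (1 / x)"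
      unfolding sums_unique[OF s] using False s
      by (intro sum_le_suminf) (auto simp: sums_iff)
    then show ?thesis by (simp add: divide_inverse_commute)
  qed
  then have "1 \<le> fact (n + 2) * exp (1 / x) * x ^ (n + 2)"
    using False by (simp add: power_one_over divide_simps mult_ac del: fact_Suc power_Suc)
  then have "1 \<le> fact (n + 2) * exp (1 / x) * (x ^ n * x\<^sup>2)"
    by (simp only: power_add)
  then show ?thesis using False
    by (simp add: flat_def exp_minus divide_simps mult_ac del: fact_Suc)
qed (simp add: flat_def)

lemma flat_DERIV: "(flat n has_real_derivative (flat (n + 2) x - n * flat (n + 1) x)) (at x)"
proof -
  consider "x < 0" | "x = 0" | "x > 0" by linarith
  then show ?thesis
  proof cases
    case 1
    have "((\<lambda>_. 0) has_real_derivative 0) (at x)" by simp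
    from has_field_derivative_transform_within_open[OF this, of "{..<0}"] 1 show ?thesis
      by (simp add: flat_def)
  next
    case 2
    have "((\<lambda>h. flat n h / h) \<longlongrightarrow> 0) (at 0)"
    proof (rule Lim_null_comparison)
      have "((\<lambda>h::real. fact (n + 2) * \<bar>h\<bar>) \<longlongrightarrow> fact (n + 2) * \<bar>0\<bar>) (at 0)" by (intro tendsto_intros)
      then show "((\<lambda>h::real. fact (n + 2) * \<bar>h\<bar>) \<longlongrightarrow> 0) (at 0)" by simp
      have "norm (flat n h / h) \<le> fact (n + 2) * \<bar>h\<bar>" for h
        using flat_le_square[of n h]
        by (cases "h = 0") (simp_all add: divide_le_eq power2_eq_square abs_mult[symmetric] mult.assoc del: fact_Suc)
      then show "eventually (\<lambda>h. norm (flat n h / h) \<le> fact (n + 2) * \<bar>h\<bar>) (at 0)" by simp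
    qed
    then show ?thesis using 2 by (simp add: DERIV_def flat_def[of _ 0])
  next
    case 3
    have "((\<lambda>x. exp (- 1 / x) / x ^ n) has_real_derivative (flat (n + 2) x - n * flat (n + 1) x)) (at x)"
      using 3
      by (auto intro!: derivative_eq_intros simp: flat_def) (cases n; simp add: field_simps power2_eq_square)
    from has_field_derivative_transform_within_open[OF this, of "{0<..}"] 3 show ?thesis
      by (simp add: flat_def)
  qed
qed

text \<open>An algebra rather than the bump alone, to have something that is closed under directional
  derivatives; \<open>r\<close> is the square of the radius of the ball that carries the bump.\<close>

inductive_set bump_class :: "real \<Rightarrow> ('b::euclidean_space \<Rightarrow> real) set" for r :: real where
  const: "(\<lambda>x::'b::euclidean_space. c) \<in> bump_class r"
| lin: "(\<lambda>x::'b::euclidean_space. x \<bullet> v) \<in> bump_class r"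
| flat: "(\<lambda>x::'b::euclidean_space. flat n (r - x \<bullet> x)) \<in> bump_class r"
| add: "f \<in> bump_class r \<Longrightarrow> h \<in> bump_class r \<Longrightarrow> (\<lambda>x. f x + h x) \<in> bump_class r"
| mult: "f \<in> bump_class r \<Longrightarrow> h \<in> bump_class r \<Longrightarrow> (\<lambda>x. f x * h x) \<in> bump_class r"

lemma bump_class_derivative:
  fixes f :: "'b::euclidean_space \<Rightarrow> real"
  shows "f \<in> bump_class r \<Longrightarrow>
    \<exists>f'. (\<forall>x. (f has_derivative f' x) (at x)) \<and> (\<forall>v. (\<lambda>x. f' x v) \<in> bump_class r)"
proof (induction rule: bump_class.induct)
  case (const c)
  show ?case
    by (rule exI[of _ "\<lambda>_ _. 0"]) (auto intro: bump_class.const)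
next
  case (lin v)
  show ?case
    by (rule exI[of _ "\<lambda>_ w. w \<bullet> v"]) (auto intro!: bump_class.const bounded_linear_imp_has_derivative bounded_linear_inner_left)
next
  case (flat n)
  have "((\<lambda>x. flat n (r - x \<bullet> x)) has_derivative
      (\<lambda>v. (flat (n + 2) (r - x \<bullet> x) + (- n) * flat (n + 1) (r - x \<bullet> x)) * (- 2 * (x \<bullet> v)))) (at x)"
    for x :: 'b
  proof -
    have "((\<lambda>x. r - x \<bullet> x) has_derivative (\<lambda>v. - 2 * (x \<bullet> v))) (at x)"
      by (auto intro!: derivative_eq_intros simp: inner_commute)
    from has_derivative_compose[OF this flat_DERIV[unfolded has_field_derivative_def]]
    show ?thesis by simp
  qed
  moreover have "(\<lambda>x. (flat (n + 2) (r - x \<bullet> x) + (- n) * flat (n + 1) (r - x \<bullet> x)) * (- 2 * (x \<bullet> v)))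
      \<in> bump_class r" for v :: 'b
    by (intro bump_class.intros)
  ultimately show ?case
    by (intro exI[of _ "\<lambda>x v. (flat (n + 2) (r - x \<bullet> x) + (- n) * flat (n + 1) (r - x \<bullet> x)) * (- 2 * (x \<bullet> v))"])
      auto
next
  case (add f h)
  from add.IH(1) obtain f' where f': "\<And>x. (f has_derivative f' x) (at x)"
    "\<And>v. (\<lambda>x. f' x v) \<in> bump_class r" by blast
  from add.IH(2) obtain h' where h': "\<And>x. (h has_derivative h' x) (at x)"
    "\<And>v. (\<lambda>x. h' x v) \<in> bump_class r" by blast
  from f' h' show ?case
    by (intro exI[of _ "\<lambda>x v. f' x v + h' x v"]) (simp add: bump_class.add has_derivative_add)
next
  case (mult f h)
  from mult.IH(1) obtain f' where f': "\<And>x. (f has_derivative f' x) (at x)"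
    "\<And>v. (\<lambda>x. f' x v) \<in> bump_class r" by blast
  from mult.IH(2) obtain h' where h': "\<And>x. (h has_derivative h' x) (at x)"
    "\<And>v. (\<lambda>x. h' x v) \<in> bump_class r" by blast
  from f' h' show ?case
    by (intro exI[of _ "\<lambda>x v. f x * h' x v + f' x v * h x"])
      (simp add: bump_class.add bump_class.mult has_derivative_mult mult.hyps)
qed

lemma flat_ball_smooth: "C_k k (\<lambda>x. flat n (r - x \<bullet> x))"
  by (rule C_k_closed_class[OF bump_class.flat bump_class_derivative])

definition mollifier :: "real \<Rightarrow> ('b::euclidean_space \<Rightarrow> real) \<Rightarrow> bool" where
  "mollifier \<epsilon> \<rho> \<longleftrightarrow> (\<forall>k. C_k k \<rho>) \<and> (\<forall>y. \<rho> y \<ge> 0) \<and> (\<forall>y. norm y \<ge> \<epsilon> \<longrightarrow> \<rho> y = 0) \<and>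
     integrable lborel \<rho> \<and> (\<integral>y. \<rho> y \<partial>lborel) = 1"

lemma integrable_continuous_bounded_support:
  fixes f :: "'b::euclidean_space \<Rightarrow> real"
  assumes "continuous_on UNIV f" "\<And>y. norm y \<ge> R \<Longrightarrow> f y = 0"
  shows "integrable lborel f"
proof -
  have "integrable lborel (\<lambda>x. indicator (cball 0 R) x *\<^sub>R f x)"
    using assms(1) by (intro borel_integrable_compact) (auto intro: continuous_on_subset)
  also have "(\<lambda>x. indicator (cball 0 R) x *\<^sub>R f x) = f"
    using assms(2) by (auto simp: indicator_def fun_eq_iff)
  finally show ?thesis .
qed

lemma mollifier_exists:
  assumes "\<epsilon> > 0"
  shows "\<exists>\<rho> :: 'b::euclidean_space \<Rightarrow> real. mollifier \<epsilon> \<rho>"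
proof -
  define b :: "'b \<Rightarrow> real" where "b x = flat 0 (\<epsilon>\<^sup>2 - x \<bullet> x)" for x
  have smooth: "C_k k b" for k unfolding b_def by (rule flat_ball_smooth)
  have nonneg: "b y \<ge> 0" for y by (simp add: b_def flat_def)
  have iff: "b y = 0 \<longleftrightarrow> norm y \<ge> \<epsilon>" for y
    using \<open>\<epsilon> > 0\<close> by (simp add: b_def flat_def dot_square_norm abs_le_square_iff[symmetric])
  have int: "integrable lborel b"
    by (rule integrable_continuous_bounded_support[OF C_k_continuous[OF smooth]]) (simp add: iff)
  define c where "c = (\<integral>y. b y \<partial>lborel)"
  have "c \<noteq> 0"
  proof
    assume "c = 0"
    then have "AE y in lborel. b y = 0"
      using integral_nonneg_eq_0_iff_AE[OF int] nonneg by (simp add: c_def)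
    then have "AE y in lborel. y \<notin> ball (0::'b) \<epsilon>" by (simp add: iff not_less)
    then have "emeasure lborel (ball (0::'b) \<epsilon>) = 0"
      by (subst (asm) AE_iff_measurable[OF _ refl]) (auto simp: ball_def)
    then show False using \<open>\<epsilon> > 0\<close> 
      using unit_ball_vol_pos[of "real DIM('b)"] by (simp add: emeasure_ball)
  qed
  moreover have "c \<ge> 0" unfolding c_def by (intro integral_nonneg_AE) (simp add: nonneg)
  ultimately have "c > 0" by simp
  then have "mollifier \<epsilon> (\<lambda>y. (1 / c) * b y)"
    unfolding mollifier_def using int nonneg iff C_k_scale[OF smooth, of _ "1 / c"]
    by (auto simp: c_def[symmetric])
  then show ?thesis by blast
qed

text \<open>All estimates on mollified functions are instances of this one: a weighted average over a
  small ball inherits any bound that holds on that ball.\<close>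

lemma mollifier_average:
  fixes u :: "'b::euclidean_space \<Rightarrow> real"
  assumes \<rho>: "mollifier \<epsilon> \<rho>" and u: "continuous_on UNIV u"
  shows "integrable lborel (\<lambda>y. u y * \<rho> y)"
    and "(\<And>y. norm y < \<epsilon> \<Longrightarrow> \<bar>u y\<bar> \<le> \<eta>) \<Longrightarrow> \<bar>\<integral>y. u y * \<rho> y \<partial>lborel\<bar> \<le> \<eta>"
proof -
  have "continuous_on UNIV \<rho>" using \<rho> C_k_continuous by (auto simp: mollifier_def)
  then show int: "integrable lborel (\<lambda>y. u y * \<rho> y)"
    using \<rho> by (intro integrable_continuous_bounded_support[of _ \<epsilon>] continuous_intros u)
      (auto simp: mollifier_def)
  assume bd: "\<And>y. norm y < \<epsilon> \<Longrightarrow> \<bar>u y\<bar> \<le> \<eta>"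
  have le: "\<bar>u y * \<rho> y\<bar> \<le> \<eta> * \<rho> y" for y
    using \<rho> bd[of y] by (cases "norm y < \<epsilon>") (auto simp: mollifier_def abs_mult intro!: mult_right_mono)
  have "\<bar>\<integral>y. u y * \<rho> y \<partial>lborel\<bar> \<le> (\<integral>y. \<bar>u y * \<rho> y\<bar> \<partial>lborel)"
    by (rule integral_abs_bound)
  also have "\<dots> \<le> (\<integral>y. \<eta> * \<rho> y \<partial>lborel)"
    using \<rho> by (intro integral_mono integrable_abs int le) (auto simp: mollifier_def)
  also have "\<dots> = \<eta>" using \<rho> by (simp add: mollifier_def)
  finally show "\<bar>\<integral>y. u y * \<rho> y \<partial>lborel\<bar> \<le> \<eta>" .
qed

definition mollify :: "('b::euclidean_space \<Rightarrow> real) \<Rightarrow> ('b \<Rightarrow> real) \<Rightarrow> 'b \<Rightarrow> real" where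
  "mollify \<rho> f z = (\<integral>y. f (z - y) * \<rho> y \<partial>lborel)"

lemma mollify_near:
  assumes "mollifier \<epsilon> \<rho>" "continuous_on UNIV f" "\<And>y. norm y < \<epsilon> \<Longrightarrow> \<bar>f (z - y) - c\<bar> \<le> \<eta>"
  shows "\<bar>mollify \<rho> f z - c\<bar> \<le> \<eta>"
proof -
  have cf: "continuous_on UNIV (\<lambda>y. f (z - y))"
    by (rule continuous_on_compose2[OF assms(2)]) (auto intro!: continuous_intros)
  have "mollify \<rho> f z - c = (\<integral>y. f (z - y) * \<rho> y - c * \<rho> y \<partial>lborel)"
    using assms(1) mollifier_average(1)[OF assms(1) cf]
    by (simp add: mollify_def mollifier_def)
  also have "\<dots> = (\<integral>y. (f (z - y) - c) * \<rho> y \<partial>lborel)" by (simp add: algebra_simps)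
  also have "\<bar>\<dots>\<bar> \<le> \<eta>"
    by (rule mollifier_average(2)[OF assms(1)]) (use assms(3) cf in \<open>auto intro!: continuous_intros\<close>)
  finally show ?thesis .
qed

text \<open>Differentiation under the integral moves a derivative to the kernel \<open>\<sigma>\<close>, and the directional
  derivatives of \<open>\<sigma>\<close> are smooth again; hence the generalisation over \<open>\<sigma>\<close> in the induction.\<close>

lemma smooth_convolution:
  fixes f \<sigma> :: "'b::euclidean_space \<Rightarrow> real"
  assumes f: "continuous_on UNIV f"
  shows "(\<And>j. C_k j \<sigma>) \<Longrightarrow> C_k k (\<lambda>z. integral (cbox a b) (\<lambda>y. f y * \<sigma> (z - y)))"
proof (induction k arbitrary: \<sigma>)
  case 0
  have c\<sigma>: "continuous_on UNIV \<sigma>" using 0 C_k_continuous by blast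
  have "continuous_on (UNIV \<times> cbox a b) (\<lambda>(z, y). f y * \<sigma> (z - y))"
    by (auto simp: case_prod_beta' intro!: continuous_intros continuous_on_compose2[OF f]
        continuous_on_compose2[OF c\<sigma>])
  from integral_continuous_on_param[OF this] show ?case by simp
next
  case (Suc k)
  define D where "D x = Blinfun (frechet_derivative \<sigma> (at x))" for x
  have d: "(\<sigma> has_derivative frechet_derivative \<sigma> (at x)) (at x)" for x
    using C_k_SucD(1)[OF Suc.prems] .
  have D: "blinfun_apply (D x) = frechet_derivative \<sigma> (at x)" for x
    unfolding D_def using d has_derivative_bounded_linear bounded_linear_Blinfun_apply by blast
  have cD: "continuous_on UNIV D"
    using C_k_continuous[OF C_k_SucD(2)[OF Suc.prems]]
    by (intro continuous_on_blinfun_componentwise) (simp add: D)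
  let ?F = "\<lambda>z y. f y *\<^sub>R D (z - y)"
  have cF: "continuous_on (UNIV \<times> cbox a b) (\<lambda>(z, y). ?F z y)"
    by (auto simp: case_prod_beta' intro!: continuous_intros continuous_on_compose2[OF f]
        continuous_on_compose2[OF cD])
  have c\<sigma>: "continuous_on UNIV \<sigma>" using Suc.prems C_k_continuous by blast
  have "((\<lambda>z. integral (cbox a b) (\<lambda>y. f y * \<sigma> (z - y))) has_derivative
      integral (cbox a b) (?F z)) (at z)" for z
  proof (rule leibniz_rule[OF _ _ cF])
    show "((\<lambda>z. f y * \<sigma> (z - y)) has_derivative ?F z y) (at z)" for z y
    proof -
      have "((\<lambda>z. z - y) has_derivative (\<lambda>v. v)) (at z)" by (auto intro!: derivative_eq_intros)
      from has_derivative_mult_right[OF has_derivative_compose[OF this d], of "f y"]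
      show ?thesis by (simp add: scaleR_blinfun.rep_eq D)
    qed
    show "(\<lambda>y. f y * \<sigma> (z - y)) integrable_on cbox a b" for z
      by (intro integrable_continuous continuous_intros continuous_on_compose2[OF f]
          continuous_on_compose2[OF c\<sigma>]) auto
  qed auto
  then show ?case
  proof (rule C_k_SucI)
    fix v
    have "?F z integrable_on cbox a b" for z
      by (intro integrable_continuous continuous_intros continuous_on_compose2[OF f]
          continuous_on_compose2[OF cD]) auto
    then have "(\<lambda>z. integral (cbox a b) (?F z) v) =
        (\<lambda>z. integral (cbox a b) (\<lambda>y. f y * frechet_derivative \<sigma> (at (z - y)) v))"
      by (simp add: blinfun_apply_integral scaleR_blinfun.rep_eq D)
    moreover have "C_k k (\<lambda>z. integral (cbox a b) (\<lambda>y. f y * frechet_derivative \<sigma> (at (z - y)) v))"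
      by (rule Suc.IH) (rule C_k_SucD(2)[OF Suc.prems])
    ultimately show "C_k k (\<lambda>z. integral (cbox a b) (?F z) v)" by simp
  qed
qed

text \<open>The substitution \<open>y \<mapsto> z - y\<close> moves the dependence on \<open>z\<close> from \<open>f\<close>, which is only
  continuous, to the smooth kernel.\<close>

lemma mollify_Cc_infty:
  assumes \<rho>: "mollifier \<epsilon> \<rho>" and f: "continuous_on UNIV f" "\<And>z. norm z > R \<Longrightarrow> f z = 0"
  shows "mollify \<rho> f \<in> Cc_infty"
proof (rule Cc_infty_I)
  fix k
  obtain a b where ab: "cball (0::'a) R \<subseteq> cbox a b"
    using bounded_subset_cbox_symmetric[of "cball (0::'a) R"] by (metis bounded_cball)
  have reflect: "lborel = distr lborel borel (\<lambda>x. z - x)" for z :: 'a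
    using lborel_affine[of "-1" z] by (simp add: density_1)
  have "mollify \<rho> f z = integral (cbox a b) (\<lambda>y. f y * \<rho> (z - y))" for z
  proof -
    let ?G = "\<lambda>y. f y * \<rho> (z - y)"
    have c\<rho>: "continuous_on UNIV \<rho>" using \<rho> C_k_continuous by (auto simp: mollifier_def)
    have cG: "continuous_on UNIV ?G"
      by (intro continuous_intros continuous_on_compose2[OF c\<rho>] f(1)) auto
    have int: "integrable lborel ?G"
      by (rule integrable_continuous_bounded_support[OF cG, of "R + 1"]) (simp add: f)
    have "(\<integral>y. ?G y \<partial>lborel) = (\<integral>y. ?G y \<partial>(distr lborel borel (\<lambda>x. z - x)))"
      using reflect[of z] by simp
    also have "\<dots> = (\<integral>y. ?G (z - y) \<partial>lborel)"
      by (rule integral_distr) (use cG in \<open>auto intro: borel_measurable_continuous_onI\<close>)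
    also have "\<dots> = mollify \<rho> f z" by (simp add: mollify_def)
    finally have "mollify \<rho> f z = integral UNIV ?G" using integral_lborel[OF int] by simp
    also have "\<dots> = integral UNIV (\<lambda>y. if y \<in> cbox a b then ?G y else 0)"
      using ab f(2) by (intro arg_cong[where f = "integral UNIV"]) (force simp: fun_eq_iff subset_iff)
    also have "\<dots> = integral (cbox a b) ?G" by (rule integral_restrict_UNIV)
    finally show ?thesis .
  qed
  then have "mollify \<rho> f = (\<lambda>z. integral (cbox a b) (\<lambda>y. f y * \<rho> (z - y)))" by auto
  then show "C_k k (mollify \<rho> f)"
    using \<rho> smooth_convolution[OF f(1), of \<rho>] by (simp add: mollifier_def)
next
  fix z :: 'a assume z: "norm z > R + \<epsilon>"
  have "f (z - y) = 0" if "norm y < \<epsilon>" for y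
    using that z norm_triangle_ineq2[of z y] by (intro f(2)) linarith
  then have "\<bar>mollify \<rho> f z - 0\<bar> \<le> 0"
    by (intro mollify_near[OF \<rho> f(1)]) auto
  then show "mollify \<rho> f z = 0" by simp
qed

text \<open>Clipping the values of \<open>h\<close> to \<open>[- \<eta> / 2, \<eta> / 2]\<close> and subtracting the result leaves a
  continuous function \<open>w\<close> of bounded support within \<open>\<eta> / 2\<close> of \<open>h\<close>, which can be mollified.\<close>

lemma Cc_infty_dense:
  assumes h: "h \<in> C_0" and "\<eta> > 0"
  shows "\<exists>f\<in>Cc_infty. \<forall>z. \<bar>f z - h z\<bar> \<le> \<eta>"
proof -
  define w where "w z = h z - max (- (\<eta> / 2)) (min (\<eta> / 2) (h z))" for z
  have cw: "continuous_on UNIV w"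
    using h unfolding w_def C_0_def by (auto intro!: continuous_intros)
  obtain R where R: "\<And>z. norm z > R \<Longrightarrow> \<bar>h z\<bar> < \<eta> / 2"
    using C_0_small_outside[OF h, of "\<eta> / 2"] \<open>\<eta> > 0\<close> by auto
  have w0: "w z = 0" if "norm z > R" for z using R[OF that] by (auto simp: w_def)
  have wh: "\<bar>w z - h z\<bar> \<le> \<eta> / 2" for z using \<open>\<eta> > 0\<close> by (auto simp: w_def)
  obtain d where d: "d > 0" "\<And>x y. norm (x - y) < d \<Longrightarrow> \<bar>w x - w y\<bar> \<le> \<eta> / 2"
    using C_0_uniformly_continuous[OF C_0_I[OF cw w0], of R "\<eta> / 2"] \<open>\<eta> > 0\<close> by auto
  obtain \<rho> :: "'a \<Rightarrow> real" where \<rho>: "mollifier d \<rho>" using mollifier_exists[OF d(1)] by blast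
  have "\<bar>mollify \<rho> w z - w z\<bar> \<le> \<eta> / 2" for z
    by (rule mollify_near[OF \<rho> cw]) (use d(2) in auto)
  then have "\<bar>mollify \<rho> w z - h z\<bar> \<le> \<eta>" for z
    using wh[of z] by (smt (verit) field_sum_of_halves)
  then show ?thesis using mollify_Cc_infty[OF \<rho> cw w0] by blast
qed

section \<open>The flow of a globally Lipschitz vector field\<close>

text \<open>The mean value inequality in both directions of time.\<close>

lemma curve_bound:
  fixes y :: "real \<Rightarrow> 'b::real_normed_vector"
  assumes "\<And>s. (y has_vector_derivative y' s) (at s)"
    and "\<And>s. (\<psi> has_real_derivative \<psi>' s) (at s)"
    and bd: "\<And>s. norm (y' s) \<le> \<psi>' \<bar>s\<bar>"
  shows "norm (y t - y 0) \<le> \<psi> \<bar>t\<bar> - \<psi> 0"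
proof -
  have pos: "norm (w t - w 0) \<le> \<psi> t - \<psi> 0"
    if "t > 0" and w: "\<And>s. (w has_vector_derivative w' s) (at s)"
      and bw: "\<And>s. s \<ge> 0 \<Longrightarrow> norm (w' s) \<le> \<psi>' s" for t :: real and w w' :: "real \<Rightarrow> 'b"
  proof (rule differentiable_bound_general[of 0 t w \<psi> w' \<psi>'])
    show "continuous_on {0..t} w"
      using w by (meson continuous_at_imp_continuous_on has_vector_derivative_continuous)
    show "continuous_on {0..t} \<psi>"
      using assms(2) by (meson continuous_at_imp_continuous_on DERIV_isCont)
    show "(\<psi> has_vector_derivative \<psi>' x) (at x)" for x
      using assms(2) by (simp add: has_real_derivative_iff_has_vector_derivative)
  qed (use that in auto)
  consider "t > 0" | "t = 0" | "t < 0" by linarith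
  then show ?thesis
  proof cases
    case 1
    then show ?thesis using pos[of t y y'] assms(1) bd by (metis abs_of_nonneg abs_of_pos)
  next
    case 2
    then show ?thesis by simp
  next
    case 3
    have "((\<lambda>s. y (- s)) has_vector_derivative - y' (- s)) (at s)" for s
    proof -
      have "((\<lambda>s::real. - s) has_vector_derivative - 1) (at s)"
        by (auto intro!: derivative_eq_intros)
      from vector_diff_chain_at[OF this assms(1)] show ?thesis by (simp add: o_def)
    qed
    moreover have "norm (- y' (- s)) \<le> \<psi>' s" if "s \<ge> 0" for s
      using bd[of "- s"] that by simp
    ultimately show ?thesis
      using pos[of "- t" "\<lambda>s. y (- s)" "\<lambda>s. - y' (- s)"] 3 by simp
  qed
qed

text \<open>\<open>ham_flow\<close> with an arbitrary vector field in place of the Hamiltonian one.\<close>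

definition flow_of :: "('b::euclidean_space \<Rightarrow> 'b) \<Rightarrow> real \<Rightarrow> 'b \<Rightarrow> 'b" where
  "flow_of g t z = (THE x. x 0 = z \<and> (\<forall>s. (x has_vector_derivative g (x s)) (at s))) t"

locale lipschitz_field =
  fixes g :: "'b::euclidean_space \<Rightarrow> 'b" and L :: real
  assumes lip: "norm (g x - g y) \<le> L * norm (x - y)" and L_pos: "L > 0"
begin

abbreviation solution :: "(real \<Rightarrow> 'b) \<Rightarrow> bool" where
  "solution x \<equiv> \<forall>s. (x has_vector_derivative g (x s)) (at s)"

abbreviation \<phi> :: "real \<Rightarrow> 'b \<Rightarrow> 'b" where "\<phi> \<equiv> flow_of g"

lemma field_continuous: "continuous_on UNIV g"
proof -
  have "L-lipschitz_on UNIV g"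
    using lip L_pos by (intro lipschitz_onI) (auto simp: dist_norm)
  then show ?thesis by (rule lipschitz_on_continuous_on)
qed

text \<open>The derivative of the squared distance of two solutions is at most \<open>2 L\<close> times it in absolute
  value. Hence \<open>exp (- 2 L t)\<close> times it is nonincreasing, which serves \<open>t \<ge> 0\<close>, and \<open>exp (2 L t)\<close>
  times it is nondecreasing, which serves \<open>t \<le> 0\<close>.\<close>

lemma solutions_diverge_slowly:
  assumes "solution x" "solution y"
  shows "norm (x t - y t) \<le> exp (L * \<bar>t\<bar>) * norm (x 0 - y 0)"
proof -
  let ?d = "\<lambda>s. (x s - y s) \<bullet> (x s - y s)"
  let ?d' = "\<lambda>s. 2 * ((x s - y s) \<bullet> (g (x s) - g (y s)))"
  have d: "(?d has_real_derivative ?d' s) (at s)" for s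
  proof -
    have "((\<lambda>s. x s - y s) has_vector_derivative (g (x s) - g (y s))) (at s)"
      using assms by (auto intro!: derivative_eq_intros)
    from has_derivative_inner[OF this[unfolded has_vector_derivative_def]
        this[unfolded has_vector_derivative_def]]
    show ?thesis
      by (rule has_derivative_imp_has_field_derivative) (simp add: inner_commute algebra_simps)
  qed
  have d': "\<bar>?d' s\<bar> \<le> 2 * L * ?d s" for s
  proof -
    have "\<bar>(x s - y s) \<bullet> (g (x s) - g (y s))\<bar> \<le> norm (x s - y s) * norm (g (x s) - g (y s))"
      by (rule Cauchy_Schwarz_ineq2)
    also have "\<dots> \<le> norm (x s - y s) * (L * norm (x s - y s))"
      by (intro mult_left_mono lip) auto
    also have "\<dots> = L * ?d s" by (simp add: dot_square_norm power2_eq_square)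
    finally show ?thesis by (simp add: abs_mult)
  qed
  have e: "((\<lambda>s. exp (c * s) * ?d s) has_real_derivative exp (c * s) * (c * ?d s + ?d' s)) (at s)"
    for c s
    by (rule derivative_eq_intros d refl | simp add: algebra_simps)+
  have "?d t \<le> exp (2 * L * \<bar>t\<bar>) * ?d 0"
  proof (cases "t \<ge> 0")
    case True
    have "exp ((- 2 * L) * t) * ?d t \<le> exp ((- 2 * L) * 0) * ?d 0"
    proof (rule DERIV_nonpos_imp_nonincreasing[OF True])
      fix s
      have "exp ((- 2 * L) * s) * ((- 2 * L) * ?d s + ?d' s) \<le> 0"
        using d'[of s] by (intro mult_nonneg_nonpos) auto
      then show "\<exists>k. ((\<lambda>s. exp ((- 2 * L) * s) * ?d s) has_real_derivative k) (at s) \<and> k \<le> 0"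
        using e by blast
    qed
    then show ?thesis using True by (simp add: exp_minus field_simps)
  next
    case False
    have "exp ((2 * L) * t) * ?d t \<le> exp ((2 * L) * 0) * ?d 0"
    proof (rule DERIV_nonneg_imp_nondecreasing[of t 0])
      fix s
      have "exp ((2 * L) * s) * ((2 * L) * ?d s + ?d' s) \<ge> 0"
        using d'[of s] by (intro mult_nonneg_nonneg) auto
      then show "\<exists>k. ((\<lambda>s. exp ((2 * L) * s) * ?d s) has_real_derivative k) (at s) \<and> 0 \<le> k"
        using e by blast
    qed (use False in simp)
    then show ?thesis using False by (simp add: exp_minus field_simps)
  qed
  then have "(norm (x t - y t))\<^sup>2 \<le> (exp (L * \<bar>t\<bar>) * norm (x 0 - y 0))\<^sup>2"
    by (simp add: dot_square_norm power_mult_distrib exp_double[symmetric] mult.assoc)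
  then show ?thesis by (rule power2_le_imp_le) simp
qed

lemma primitive_exists:
  fixes h :: "real \<Rightarrow> 'b"
  assumes "continuous_on UNIV h"
  shows "\<exists>\<Gamma>. \<Gamma> 0 = 0 \<and> (\<forall>s. (\<Gamma> has_vector_derivative h s) (at s))"
proof -
  obtain F where F: "\<And>s::real. (F has_vector_derivative h s) (at s)"
    using einterval_antiderivative[of "-\<infinity>" "\<infinity>" h] assms
    by (auto simp: continuous_on_eq_continuous_at)
  have "((\<lambda>s. F s - F 0) has_vector_derivative h s) (at s)" for s
    using F by (auto intro!: derivative_eq_intros)
  then show ?thesis by (intro exI[of _ "\<lambda>s. F s - F 0"]) auto
qed

text \<open>Picard iteration is a contraction on all of the time axis at once when curves are compared
  with the weight \<open>exp (- 2 L \<bar>t\<bar>)\<close>: the unknown is the bounded function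
  \<open>u t = exp (- 2 L \<bar>t\<bar>) (x t - z)\<close>.\<close>

lemma solution_exists: "\<exists>x. x 0 = z \<and> solution x"
proof -
  define K where "K = 2 * L"
  have K: "K > 0" using L_pos by (simp add: K_def)
  define c :: "(real \<Rightarrow>\<^sub>C 'b) \<Rightarrow> real \<Rightarrow> 'b"
    where "c u s = z + exp (K * \<bar>s\<bar>) *\<^sub>R u s" for u s
  have cont: "continuous_on UNIV (\<lambda>s. g (c u s))" for u
    unfolding c_def
    by (rule continuous_on_compose2[OF field_continuous]) (auto intro!: continuous_intros)
  define \<Gamma> where
    "\<Gamma> u = (SOME \<Gamma>. \<Gamma> 0 = 0 \<and> (\<forall>s. (\<Gamma> has_vector_derivative g (c u s)) (at s)))" for u
  have \<Gamma>: "\<Gamma> u 0 = 0" "(\<Gamma> u has_vector_derivative g (c u s)) (at s)" for u s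
    using someI_ex[OF primitive_exists[OF cont[of u]]] by (auto simp: \<Gamma>_def)
  define T where "T u = Bcontfun (\<lambda>t. exp (- K * \<bar>t\<bar>) *\<^sub>R \<Gamma> u t)" for u
  have expo: "((\<lambda>s. C / K * exp (K * s)) has_real_derivative C * exp (K * s)) (at s)" for C s
    using K by (auto intro!: derivative_eq_intros)
  have scale: "norm (exp (- K * \<bar>t\<bar>) *\<^sub>R v) \<le> C / K"
    if "norm v \<le> C / K * exp (K * \<bar>t\<bar>) - C / K" "C \<ge> 0" for v :: 'b and C t
  proof -
    have "norm v \<le> C / K * exp (K * \<bar>t\<bar>)"
      using that K by (simp add: order_trans[OF that(1)])
    then have "norm (exp (- K * \<bar>t\<bar>) *\<^sub>R v) \<le> exp (- K * \<bar>t\<bar>) * (C / K * exp (K * \<bar>t\<bar>))"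
      by (simp only: norm_scaleR abs_exp_cancel) (rule mult_left_mono, auto)
    also have "\<dots> = C / K" by (simp add: exp_minus)
    finally show ?thesis .
  qed
  have T_app: "apply_bcontfun (T u) t = exp (- K * \<bar>t\<bar>) *\<^sub>R \<Gamma> u t" for u t
  proof -
    have u_le: "norm (u s) \<le> norm u" for s
      by (rule norm_bounded)
    have "norm (g (c u s)) \<le> (norm (g z) + L * norm u) * exp (K * \<bar>s\<bar>)" for s
    proof -
      have "norm (g (c u s)) \<le> norm (g z) + norm (g (c u s) - g z)"
        by (metis add_diff_cancel_left' diff_add_cancel norm_triangle_ineq add.commute)
      also have "\<dots> \<le> norm (g z) + L * (exp (K * \<bar>s\<bar>) * norm (u s))"
        using lip[of "c u s" z] by (simp add: c_def)
      also have "\<dots> \<le> norm (g z) * exp (K * \<bar>s\<bar>) + L * (exp (K * \<bar>s\<bar>) * norm u)"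
        using L_pos K u_le by (intro add_mono mult_left_mono) (auto simp: mult_le_cancel_left1)
      finally show ?thesis by (simp add: algebra_simps)
    qed
    from curve_bound[of "\<Gamma> u", OF \<Gamma>(2) expo this]
    have "norm (\<Gamma> u t) \<le> (norm (g z) + L * norm u) / K * exp (K * \<bar>t\<bar>) - (norm (g z) + L * norm u) / K"
      for t
      by (simp add: \<Gamma>(1))
    then have "norm (exp (- K * \<bar>t\<bar>) *\<^sub>R \<Gamma> u t) \<le> (norm (g z) + L * norm u) / K" for t
      using L_pos by (intro scale) auto
    moreover have "continuous_on UNIV (\<Gamma> u)"
      using \<Gamma>(2) by (meson continuous_at_imp_continuous_on has_vector_derivative_continuous)
    ultimately have "(\<lambda>t. exp (- K * \<bar>t\<bar>) *\<^sub>R \<Gamma> u t) \<in> bcontfun"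
      by (intro bcontfun_normI) (auto intro!: continuous_intros)
    then show ?thesis by (simp add: T_def Bcontfun_inverse)
  qed
  have "dist (T u) (T v) \<le> 1 / 2 * dist u v" for u v
  proof (rule dist_bound)
    fix t
    have "((\<lambda>s. \<Gamma> u s - \<Gamma> v s) has_vector_derivative (g (c u s) - g (c v s))) (at s)" for s
      using \<Gamma>(2) by (auto intro!: derivative_eq_intros)
    moreover have "norm (g (c u s) - g (c v s)) \<le> L * dist u v * exp (K * \<bar>s\<bar>)" for s
    proof -
      have "norm (g (c u s) - g (c v s)) \<le> L * norm (c u s - c v s)" by (rule lip)
      also have "c u s - c v s = exp (K * \<bar>s\<bar>) *\<^sub>R (u s - v s)"
        by (simp add: c_def algebra_simps)
      also have "L * norm \<dots> \<le> L * (exp (K * \<bar>s\<bar>) * dist u v)"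
        using L_pos dist_bounded[of u s v] by (auto simp: dist_norm)
      finally show ?thesis by (simp add: algebra_simps)
    qed
    ultimately have "norm (\<Gamma> u t - \<Gamma> v t) \<le> L * dist u v / K * exp (K * \<bar>t\<bar>) - L * dist u v / K"
      using curve_bound[of "\<lambda>s. \<Gamma> u s - \<Gamma> v s", OF _ expo] \<Gamma>(1) by fastforce
    then have "norm (exp (- K * \<bar>t\<bar>) *\<^sub>R (\<Gamma> u t - \<Gamma> v t)) \<le> L * dist u v / K"
      using L_pos by (intro scale) auto
    then show "dist (T u t) (T v t) \<le> 1 / 2 * dist u v"
      using L_pos by (simp add: T_app dist_norm scaleR_diff_right K_def)
  qed
  then obtain u where u: "T u = u"
    using banach_fix_type[of "1/2" T] by auto
  have eq: "c u = (\<lambda>t. z + \<Gamma> u t)"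
    using T_app[of u] u by (auto simp: c_def exp_minus)
  have "((\<lambda>t. z + \<Gamma> u t) has_vector_derivative g (c u s)) (at s)" for s
    using \<Gamma>(2) by (auto intro!: derivative_eq_intros)
  then have "solution (c u)" by (simp add: eq)
  moreover have "c u 0 = z" by (simp add: eq \<Gamma>(1))
  ultimately show ?thesis by blast
qed

lemma solution_unique:
  assumes "solution x" "solution y" "x 0 = y 0"
  shows "x = y"
  using solutions_diverge_slowly[OF assms(1,2)] assms(3) by auto

lemma flow_is_solution: "\<phi> 0 z = z" "((\<lambda>s. \<phi> s z) has_vector_derivative g (\<phi> s z)) (at s)"
proof -
  let ?P = "\<lambda>x. x 0 = z \<and> solution x"
  have "\<exists>!x. ?P x"
    using solution_exists solution_unique by (metis (no_types, lifting))
  from theI'[OF this] show "\<phi> 0 z = z" "((\<lambda>s. \<phi> s z) has_vector_derivative g (\<phi> s z)) (at s)"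
    by (auto simp: flow_of_def)
qed

lemma flow_eqI: "x 0 = z \<Longrightarrow> solution x \<Longrightarrow> \<phi> t z = x t"
  using solution_unique[of "\<lambda>s. \<phi> s z" x] flow_is_solution by metis

lemma flow_add: "\<phi> (t + s) z = \<phi> t (\<phi> s z)"
proof -
  have "((\<lambda>t. \<phi> (t + s) z) has_vector_derivative g (\<phi> (t + s) z)) (at t)" for t
  proof -
    have "((\<lambda>t. t + s) has_vector_derivative 1) (at t)"
      by (auto intro!: derivative_eq_intros)
    from vector_diff_chain_at[OF this flow_is_solution(2)] show ?thesis by (simp add: o_def)
  qed
  then show ?thesis by (intro flow_eqI[of "\<lambda>t. \<phi> (t + s) z", symmetric]) auto
qed

lemma flow_inverse: "\<phi> (- t) (\<phi> t z) = z"
  using flow_add[of "- t" t z] by (simp add: flow_is_solution)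

lemma flow_lipschitz: "norm (\<phi> t z - \<phi> t w) \<le> exp (L * \<bar>t\<bar>) * norm (z - w)"
  using solutions_diverge_slowly[of "\<lambda>s. \<phi> s z" "\<lambda>s. \<phi> s w"] by (simp add: flow_is_solution)

text \<open>The two orbits separate with speed at most \<open>L\<close> times their distance, so the difference of the
  displacements is of order \<open>t\<close>. This controls the commutator of mollification with
  differentiation along the flow.\<close>

lemma flow_almost_commutes_with_translation:
  "norm (\<phi> t z - \<phi> t w - (z - w)) \<le> (exp (L * \<bar>t\<bar>) - 1) * norm (z - w)"
proof -
  have 1: "((\<lambda>t. \<phi> t z - \<phi> t w) has_vector_derivative (g (\<phi> s z) - g (\<phi> s w))) (at s)" for s
    using flow_is_solution(2) by (auto intro!: derivative_eq_intros)
  have 2: "((\<lambda>s. exp (L * s) * norm (z - w)) has_real_derivative L * exp (L * s) * norm (z - w)) (at s)"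
    for s
    by (auto intro!: derivative_eq_intros)
  have 3: "norm (g (\<phi> s z) - g (\<phi> s w)) \<le> L * exp (L * \<bar>s\<bar>) * norm (z - w)" for s
    using order_trans[OF lip mult_left_mono[OF flow_lipschitz]] L_pos by (simp add: mult.assoc)
  from curve_bound[of "\<lambda>t. \<phi> t z - \<phi> t w", OF 1 2 3] show ?thesis
    by (simp add: flow_is_solution algebra_simps)
qed

lemma flow_jointly_continuous: "continuous_on UNIV (\<lambda>(t, z). \<phi> t z)"
proof (rule continuous_at_imp_continuous_on, intro ballI, safe)
  fix t0 z0
  have "((\<lambda>p. exp (L * \<bar>fst p\<bar>) * norm (snd p - z0) + norm (\<phi> (fst p) z0 - \<phi> t0 z0)) \<longlongrightarrow>
      exp (L * \<bar>t0\<bar>) * norm (z0 - z0) + norm (\<phi> t0 z0 - \<phi> t0 z0)) (at (t0, z0))"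
    by (intro tendsto_intros isCont_tendsto_compose[where g = "\<lambda>t. \<phi> t z0"]
        has_vector_derivative_continuous[OF flow_is_solution(2)])
      (auto intro!: tendsto_eq_intros)
  then have lim: "((\<lambda>p. exp (L * \<bar>fst p\<bar>) * norm (snd p - z0) + norm (\<phi> (fst p) z0 - \<phi> t0 z0)) \<longlongrightarrow> 0)
      (at (t0, z0))" by simp
  have "norm (\<phi> t z - \<phi> t0 z0) \<le> exp (L * \<bar>t\<bar>) * norm (z - z0) + norm (\<phi> t z0 - \<phi> t0 z0)" for t z
    using norm_triangle_ineq[of "\<phi> t z - \<phi> t z0" "\<phi> t z0 - \<phi> t0 z0"] flow_lipschitz[of t z z0] by simp
  then have "((\<lambda>p. (\<lambda>(t, z). \<phi> t z) p - \<phi> t0 z0) \<longlongrightarrow> 0) (at (t0, z0))"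
    by (intro Lim_null_comparison[OF _ lim] always_eventually) (simp add: case_prod_beta')
  then show "isCont (\<lambda>(t, z). \<phi> t z) (t0, z0)"
    by (simp add: isCont_def LIM_zero_iff)
qed

lemma flow_continuous: "continuous_on UNIV (\<phi> t)"
proof -
  have "continuous_on UNIV (\<lambda>z. (\<lambda>(t, z). \<phi> t z) (t, z))"
    by (intro continuous_on_compose2[OF flow_jointly_continuous] continuous_intros) auto
  then show ?thesis by simp
qed

text \<open>Points that reach the ball of radius \<open>R\<close> within time \<open>T\<close> lie in the image of a compact set
  under the backward flow.\<close>

lemma flow_proper: "\<exists>S. \<forall>t z. \<bar>t\<bar> \<le> T \<longrightarrow> norm z > S \<longrightarrow> norm (\<phi> t z) > R"
proof -
  have "compact ((\<lambda>(t, z). \<phi> t z) ` ({- T..T} \<times> cball 0 R))"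
    by (intro compact_continuous_image continuous_on_subset[OF flow_jointly_continuous] compact_Times)
      auto
  then obtain S where S: "\<And>x. x \<in> (\<lambda>(t, z). \<phi> t z) ` ({- T..T} \<times> cball 0 R) \<Longrightarrow> norm x \<le> S"
    by (metis compact_imp_bounded bounded_iff)
  have "norm z \<le> S" if "\<bar>t\<bar> \<le> T" "norm (\<phi> t z) \<le> R" for t z
  proof (rule S)
    have "z = (\<lambda>(t, z). \<phi> t z) (- t, \<phi> t z)" by (simp add: flow_inverse)
    then show "z \<in> (\<lambda>(t, z). \<phi> t z) ` ({- T..T} \<times> cball 0 R)"
      by (rule image_eqI) (use that in auto)
  qed
  then show ?thesis by (meson not_le)
qed

text \<open>Points that start far away stay far away up to time one, where \<open>f\<close> is small; on the
  remaining ball the flow moves points by a uniformly small distance.\<close>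

lemma transport_strongly_continuous:
  assumes f: "f \<in> C_0" and "e > 0"
  shows "\<exists>d>0. \<forall>t z. \<bar>t\<bar> \<le> d \<longrightarrow> \<bar>f (\<phi> t z) - f z\<bar> \<le> e"
proof -
  have cf: "continuous_on UNIV f" using f by (simp add: C_0_def)
  obtain R where R: "\<And>z. norm z > R \<Longrightarrow> \<bar>f z\<bar> < e / 2"
    using C_0_small_outside[OF f, of "e / 2"] \<open>e > 0\<close> by auto
  obtain S where S: "\<And>t z. \<bar>t\<bar> \<le> 1 \<Longrightarrow> norm z > S \<Longrightarrow> norm (\<phi> t z) > R"
    using flow_proper by blast
  let ?K = "{-1..1::real} \<times> cball (0::'b) (max R S)"
  have "uniformly_continuous_on ?K (\<lambda>(t, z). f (\<phi> t z))"
    using continuous_on_compose2[OF cf flow_jointly_continuous]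
    by (intro compact_uniformly_continuous compact_Times)
      (auto intro: continuous_on_subset simp: case_prod_beta')
  then obtain d where d: "d > 0"
    "\<And>p p'. p \<in> ?K \<Longrightarrow> p' \<in> ?K \<Longrightarrow> dist p' p < d \<Longrightarrow>
      dist ((\<lambda>(t, z). f (\<phi> t z)) p') ((\<lambda>(t, z). f (\<phi> t z)) p) < e"
    using \<open>e > 0\<close> unfolding uniformly_continuous_on_def by metis
  have "\<bar>f (\<phi> t z) - f z\<bar> \<le> e" if "\<bar>t\<bar> \<le> min 1 (d / 2)" for t z
  proof (cases "norm z \<le> max R S")
    case True
    then have "(t, z) \<in> ?K" "(0, z) \<in> ?K" "dist (t, z) (0, z) < d"
      using that d by (auto simp: dist_prod_def)
    from d(2)[OF this(2,1,3)] show ?thesis by (simp add: dist_real_def flow_is_solution)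
  next
    case False
    then have "norm z > R" "norm (\<phi> t z) > R" using that S by auto
    then show ?thesis using R[of z] R[of "\<phi> t z"] by linarith
  qed
  then show ?thesis using d(1) by (intro exI[of _ "min 1 (d / 2)"]) auto
qed

text \<open>By the mean value theorem the difference quotient of \<open>f\<close> along an orbit is a value of its
  derivative \<open>k\<close> at a nearby time, so it converges as uniformly as the transport of \<open>k\<close>.\<close>

lemma orbit_difference_quotient:
  assumes k: "k \<in> C_0" and der: "\<And>z s. ((\<lambda>s. f (\<phi> s z)) has_real_derivative k (\<phi> s z)) (at s)"
    and "e > 0"
  shows "\<exists>d>0. \<forall>t z. 0 < t \<and> t \<le> d \<longrightarrow> \<bar>(1 / t) * (f (\<phi> t z) - f z) - k z\<bar> \<le> e"
proof -
  obtain d where d: "d > 0" "\<And>t z. \<bar>t\<bar> \<le> d \<Longrightarrow> \<bar>k (\<phi> t z) - k z\<bar> \<le> e"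
    using transport_strongly_continuous[OF k \<open>e > 0\<close>] by blast
  have "\<bar>(1 / t) * (f (\<phi> t z) - f z) - k z\<bar> \<le> e" if t: "0 < t" "t \<le> d" for t z
  proof -
    obtain s where s: "0 < s" "s < t" "f (\<phi> t z) - f (\<phi> 0 z) = (t - 0) * k (\<phi> s z)"
      using MVT2[of 0 t "\<lambda>s. f (\<phi> s z)" "\<lambda>s. k (\<phi> s z)"] t der by auto
    then have "(1 / t) * (f (\<phi> t z) - f z) = k (\<phi> s z)"
      using t by (simp add: flow_is_solution)
    then show ?thesis using d(2)[of s z] s t by simp
  qed
  then show ?thesis using d(1) by blast
qed

end

section \<open>The resolvent equation along the flow\<close>

lemma exponential_density_prob:
  assumes "\<nu> > 0"
  shows "integrable lborel (exponential_density \<nu>)" "(\<integral>t. exponential_density \<nu> t \<partial>lborel) = 1"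
proof -
  interpret prob_space "density lborel (exponential_density \<nu>)"
    by (rule prob_space_exponential_density[OF assms])
  have nn: "exponential_density \<nu> t \<ge> 0" for t
    using assms by (simp add: exponential_density_def)
  have "integrable (density lborel (exponential_density \<nu>)) (\<lambda>_. 1::real)" by simp
  then show "integrable lborel (exponential_density \<nu>)"
    by (subst (asm) integrable_density) (auto simp: nn)
  have "(\<integral>t. (1::real) \<partial>density lborel (exponential_density \<nu>)) = 1" using prob_space by simp
  then show "(\<integral>t. exponential_density \<nu> t \<partial>lborel) = 1"
    by (subst (asm) integral_density) (auto simp: nn)
qed

lemma integrable_exponential_density_mult:
  fixes u :: "real \<Rightarrow> real"
  assumes "\<nu> > 0" "continuous_on UNIV u" "\<And>t. \<bar>u t\<bar> \<le> B"
  shows "integrable lborel (\<lambda>t. exponential_density \<nu> t * u t)"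
proof (rule Bochner_Integration.integrable_bound)
  show "integrable lborel (\<lambda>t. B * exponential_density \<nu> t)"
    using exponential_density_prob[OF assms(1)] by simp
  show "(\<lambda>t. exponential_density \<nu> t * u t) \<in> borel_measurable lborel"
    using borel_measurable_continuous_onI[OF assms(2)] by simp
  have "\<bar>exponential_density \<nu> t\<bar> * \<bar>u t\<bar> \<le> \<bar>B\<bar> * \<bar>exponential_density \<nu> t\<bar>" for t
    using assms(3)[of t] by (subst mult.commute, intro mult_right_mono) auto
  then show "AE t in lborel. norm (exponential_density \<nu> t * u t) \<le> norm (B * exponential_density \<nu> t)"
    by (simp add: abs_mult)
qed

lemma exponential_average_bound:
  fixes u :: "real \<Rightarrow> real"
  assumes "\<nu> > 0" "continuous_on UNIV u" "\<And>t. \<bar>u t\<bar> \<le> B"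
  shows "\<bar>\<integral>t. exponential_density \<nu> t * u t \<partial>lborel\<bar> \<le> B"
proof -
  have nn: "exponential_density \<nu> t \<ge> 0" for t
    using assms by (simp add: exponential_density_def)
  have "\<bar>\<integral>t. exponential_density \<nu> t * u t \<partial>lborel\<bar> \<le> (\<integral>t. \<bar>exponential_density \<nu> t * u t\<bar> \<partial>lborel)"
    by (rule integral_abs_bound)
  also have "\<dots> \<le> (\<integral>t. exponential_density \<nu> t * B \<partial>lborel)"
    using exponential_density_prob[OF assms(1)] nn
    by (intro integral_mono integrable_abs integrable_exponential_density_mult[OF assms])
      (auto simp: abs_mult intro!: mult_left_mono assms)
  also have "\<dots> = B" using exponential_density_prob[OF assms(1)] by simp
  finally show ?thesis .
qed

text \<open>Up to the factor \<open>exp (\<nu> s)\<close>, the average of the shifted function is the tail integral of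
  \<open>\<nu> exp (- \<nu> t) u t\<close> over \<open>t \<ge> s\<close>.\<close>

lemma exponential_average_derivative:
  fixes u :: "real \<Rightarrow> real"
  assumes \<nu>: "\<nu> > 0" and u: "continuous_on UNIV u" "\<And>t. \<bar>u t\<bar> \<le> B"
  defines "T \<equiv> \<lambda>s. \<integral>t. exponential_density \<nu> t * u (t + s) \<partial>lborel"
  shows "(T has_real_derivative \<nu> * (T s - u s)) (at s)"
proof -
  define w where "w t = \<nu> * exp (- \<nu> * t) * u t" for t
  define G where "G s = (\<integral>t. indicator {s..} t * w t \<partial>lborel)" for s
  have cw: "continuous_on UNIV w" unfolding w_def using u by (intro continuous_intros)
  have shift: "exponential_density \<nu> (- s + 1 * t) * u ((- s + 1 * t) + s) =
      exp (\<nu> * s) * (indicator {s..} t * w t)" for s t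
    by (simp add: exponential_density_def w_def indicator_def exp_diff exp_minus field_simps)
  have int: "integrable lborel (\<lambda>t. exponential_density \<nu> t * u (t + s))" for s
    using \<nu> u by (intro integrable_exponential_density_mult[where B = B] continuous_on_compose2[OF u(1)])
      (auto intro!: continuous_intros)
  have "integrable lborel (\<lambda>t. exp (\<nu> * s) * (indicator {s..} t * w t))" for s
    using lborel_integrable_real_affine[OF int, of 1 "- s" s] shift by simp
  then have intG: "integrable lborel (\<lambda>t. indicator {s..} t * w t)" for s
    by simp
  have TG: "T s = exp (\<nu> * s) * G s" for s
    unfolding T_def G_def using lborel_integral_real_affine[of 1 "\<lambda>t. exponential_density \<nu> t * u (t + s)" "- s"]
      shift[of s] by simp
  define a where "a = s - 1"
  have GI: "G x = G a - integral {a..x} w" if "x \<in> {a..s + 1}" for x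
  proof -
    have "G a - G x = (\<integral>t. indicator {a..} t * w t - indicator {x..} t * w t \<partial>lborel)"
      unfolding G_def by (rule Bochner_Integration.integral_diff[symmetric]; rule intG)
    also have "\<dots> = (\<integral>t. indicator {a..x} t *\<^sub>R w t \<partial>lborel)"
    proof (rule integral_cong_AE)
      show "AE t in lborel. indicator {a..} t * w t - indicator {x..} t * w t = indicator {a..x} t *\<^sub>R w t"
        using AE_lborel_singleton[of x] by eventually_elim (use that in \<open>auto simp: indicator_def\<close>)
    qed (use borel_measurable_continuous_onI[OF cw] in auto)
    also have "\<dots> = integral {a..x} w"
    proof -
      have "set_integrable lborel {a..x} w"
        unfolding set_integrable_def
        by (rule borel_integrable_compact) (use cw in \<open>auto intro: continuous_on_subset\<close>)
      from set_borel_integral_eq_integral(2)[OF this] show ?thesis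
        by (simp add: set_lebesgue_integral_def)
    qed
    finally show ?thesis by simp
  qed
  have "((\<lambda>x. integral {a..x} w) has_real_derivative w s) (at s within {a..s + 1})"
    by (rule integral_has_real_derivative) (use cw in \<open>auto intro: continuous_on_subset simp: a_def\<close>)
  then have "((\<lambda>x. integral {a..x} w) has_real_derivative w s) (at s)"
    by (simp add: at_within_Icc_at a_def)
  then have "((\<lambda>x. G a - integral {a..x} w) has_real_derivative - w s) (at s)"
    by (auto intro!: derivative_eq_intros)
  then have "(G has_real_derivative - w s) (at s)"
  proof (rule has_field_derivative_transform_within_open[of _ _ _ "{a<..<s + 1}"])
    show "G a - integral {a..x} w = G x" if "x \<in> {a<..<s + 1}" for x
      using that by (intro GI[symmetric]) auto
  qed (auto simp: a_def)
  then have "((\<lambda>s. exp (\<nu> * s) * G s) has_real_derivative \<nu> * (exp (\<nu> * s) * G s) + exp (\<nu> * s) * (- w s)) (at s)"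
    by (auto intro!: derivative_eq_intros)
  moreover have "exp (\<nu> * s) * w s = \<nu> * u s" by (simp add: w_def exp_minus)
  moreover have "T = (\<lambda>s. exp (\<nu> * s) * G s)" using TG by (rule ext)
  ultimately show ?thesis by (simp add: right_diff_distrib)
qed

context lipschitz_field
begin

lemma test_function_orbit_derivative:
  assumes "f \<in> Cc_infty"
  shows "((\<lambda>s. f (\<phi> s z)) has_real_derivative lie_derivative g f (\<phi> s z)) (at s)"
proof -
  have "linear (frechet_derivative f (at (\<phi> s z)))"
    using has_derivative_linear[OF Cc_infty_derivative[OF assms]] .
  then have "frechet_derivative f (at (\<phi> s z)) (x *\<^sub>R g (\<phi> s z)) = x * lie_derivative g f (\<phi> s z)" for x
    by (simp add: lie_derivative_def linear_cmul)
  with has_derivative_compose[OF flow_is_solution(2)[of z s, unfolded has_vector_derivative_def]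
      Cc_infty_derivative[OF assms]]
  show ?thesis
    by (intro has_derivative_imp_has_field_derivative) (auto simp: mult.commute)
qed

text \<open>Averaging along orbits, \<open>\<integral> exp (- \<nu> t) h (\<phi> t z) dt\<close>, solves \<open>\<nu> f - A f = h\<close> for the
  derivative \<open>A\<close> along the flow.\<close>

definition resolvent :: "real \<Rightarrow> ('b \<Rightarrow> real) \<Rightarrow> 'b \<Rightarrow> real" where
  "resolvent \<nu> h z = (1 / \<nu>) * (\<integral>t. exponential_density \<nu> t * h (\<phi> t z) \<partial>lborel)"

context
  fixes \<nu> B :: real and h :: "'b \<Rightarrow> real"
  assumes \<nu>: "\<nu> > 0" and h: "continuous_on UNIV h" "\<And>z. \<bar>h z\<bar> \<le> B"
begin

lemma orbit_continuous: "continuous_on UNIV (\<lambda>t. h (\<phi> t z))"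
proof (rule continuous_on_compose2[OF h(1)])
  show "continuous_on UNIV (\<lambda>t. \<phi> t z)"
    using flow_is_solution(2) by (meson continuous_at_imp_continuous_on has_vector_derivative_continuous)
qed simp

lemma resolvent_bound: "\<bar>resolvent \<nu> h z\<bar> \<le> B / \<nu>"
  using exponential_average_bound[OF \<nu> orbit_continuous h(2), of z] \<nu>
  by (simp add: resolvent_def abs_mult divide_right_mono)

lemma resolvent_orbit_derivative:
  "((\<lambda>s. resolvent \<nu> h (\<phi> s z)) has_real_derivative
     \<nu> * resolvent \<nu> h (\<phi> s z) - h (\<phi> s z)) (at s)"
proof -
  from exponential_average_derivative[OF \<nu> orbit_continuous h(2), of z s]
  have "((\<lambda>s. (1 / \<nu>) * (\<integral>t. exponential_density \<nu> t * h (\<phi> (t + s) z) \<partial>lborel)) has_real_derivative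
      (1 / \<nu>) * (\<nu> * ((\<integral>t. exponential_density \<nu> t * h (\<phi> (t + s) z) \<partial>lborel) - h (\<phi> s z)))) (at s)"
    by (rule DERIV_cmult)
  then show ?thesis using \<nu> by (simp add: resolvent_def flow_add)
qed

lemma resolvent_lipschitz:
  assumes "\<nu> > L" and M: "M > 0" "\<And>x y. \<bar>h x - h y\<bar> \<le> M * norm (x - y)"
  shows "\<bar>resolvent \<nu> h z - resolvent \<nu> h w\<bar> \<le> M / (\<nu> - L) * norm (z - w)"
proof -
  let ?e = "exponential_density \<nu>"
  have int: "integrable lborel (\<lambda>t. ?e t * h (\<phi> t z))" for z
    by (rule integrable_exponential_density_mult[OF \<nu> orbit_continuous h(2)])
  have ee: "?e t * exp (L * \<bar>t\<bar>) = \<nu> / (\<nu> - L) * exponential_density (\<nu> - L) t" for t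
  proof -
    have "\<nu> / (\<nu> - L) * ((\<nu> - L) * exp (- t * (\<nu> - L))) = \<nu> * exp (- t * (\<nu> - L))"
      using assms(1) by simp
    moreover have "exp (- t * (\<nu> - L)) = exp (- t * \<nu>) * exp (L * t)"
      by (simp add: algebra_simps flip: exp_add)
    ultimately have "\<nu> / (\<nu> - L) * ((\<nu> - L) * exp (- t * (\<nu> - L))) = \<nu> * (exp (- t * \<nu>) * exp (L * t))"
      by metis
    then show ?thesis by (simp add: exponential_density_def)
  qed
  have nn: "?e t \<ge> 0" for t using \<nu> by (simp add: exponential_density_def)
  have e1: "integrable lborel (exponential_density (\<nu> - L))"
      "(\<integral>t. exponential_density (\<nu> - L) t \<partial>lborel) = 1"
    using exponential_density_prob[of "\<nu> - L"] assms(1) by auto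
  have pt: "\<bar>?e t * h (\<phi> t z) - ?e t * h (\<phi> t w)\<bar> \<le>
      M * norm (z - w) * (\<nu> / (\<nu> - L)) * exponential_density (\<nu> - L) t" for t
  proof -
    have "\<bar>?e t * h (\<phi> t z) - ?e t * h (\<phi> t w)\<bar> = ?e t * \<bar>h (\<phi> t z) - h (\<phi> t w)\<bar>"
      using nn[of t] by (simp add: abs_mult flip: right_diff_distrib)
    also have "\<dots> \<le> ?e t * (M * (exp (L * \<bar>t\<bar>) * norm (z - w)))"
      using nn M flow_lipschitz[of t z w]
      by (intro mult_left_mono order_trans[OF M(2)]) auto
    also have "\<dots> = M * norm (z - w) * (?e t * exp (L * \<bar>t\<bar>))" by (simp add: algebra_simps)
    finally show ?thesis by (simp only: ee mult.assoc)
  qed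
  have "\<bar>\<integral>t. ?e t * h (\<phi> t z) - ?e t * h (\<phi> t w) \<partial>lborel\<bar> \<le>
      (\<integral>t. \<bar>?e t * h (\<phi> t z) - ?e t * h (\<phi> t w)\<bar> \<partial>lborel)"
    by (rule integral_abs_bound)
  also have "\<dots> \<le> (\<integral>t. M * norm (z - w) * (\<nu> / (\<nu> - L)) * exponential_density (\<nu> - L) t \<partial>lborel)"
    using e1 by (intro integral_mono integrable_abs Bochner_Integration.integrable_diff int pt) auto
  also have "\<dots> = M * norm (z - w) * (\<nu> / (\<nu> - L))" using e1 by simp
  finally have "\<bar>(\<integral>t. ?e t * h (\<phi> t z) \<partial>lborel) - (\<integral>t. ?e t * h (\<phi> t w) \<partial>lborel)\<bar> \<le>
      M * norm (z - w) * (\<nu> / (\<nu> - L))"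
    using int by simp
  then have "(1 / \<nu>) * \<bar>(\<integral>t. ?e t * h (\<phi> t z) \<partial>lborel) - (\<integral>t. ?e t * h (\<phi> t w) \<partial>lborel)\<bar> \<le>
      (1 / \<nu>) * (M * norm (z - w) * (\<nu> / (\<nu> - L)))"
    using \<nu> by (intro mult_left_mono) auto
  then show ?thesis using \<nu>
    by (simp add: resolvent_def abs_mult flip: right_diff_distrib diff_divide_distrib)
qed

end

text \<open>Mollification nearly commutes with differentiation along the flow: the flow of the translate
  \<open>z - y\<close> differs from the translate of the flow by \<open>O (t \<epsilon>)\<close>, which the Lipschitz function \<open>f\<close>
  transfers to the difference quotient.\<close>

lemma mollify_orbit_derivative:
  assumes \<rho>: "mollifier \<epsilon> \<rho>" "\<epsilon> > 0"
    and f: "\<And>z. norm z > R \<Longrightarrow> f z = 0"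
    and M: "M > 0" "\<And>x y. \<bar>f x - f y\<bar> \<le> M * norm (x - y)"
    and k: "k \<in> C_0" "\<And>z s. ((\<lambda>s. f (\<phi> s z)) has_real_derivative k (\<phi> s z)) (at s)"
  shows "\<bar>lie_derivative g (mollify \<rho> f) z - mollify \<rho> k z\<bar> \<le> M * (L + 1) * \<epsilon>"
proof (rule field_le_epsilon)
  fix e :: real assume "e > 0"
  have "M-lipschitz_on UNIV f" using M by (intro lipschitz_onI) (auto simp: dist_norm)
  then have cf: "continuous_on UNIV f" by (rule lipschitz_on_continuous_on)
  have ck: "continuous_on UNIV k" using k by (simp add: C_0_def)
  let ?F = "mollify \<rho> f"
  have F: "?F \<in> Cc_infty" by (rule mollify_Cc_infty[OF \<rho>(1) cf f])
  obtain d1 where d1: "d1 > 0" "\<And>t z. 0 < t \<Longrightarrow> t \<le> d1 \<Longrightarrow>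
      \<bar>(1 / t) * (?F (\<phi> t z) - ?F z) - lie_derivative g ?F z\<bar> \<le> e / 2"
    using orbit_difference_quotient[OF lie_derivative_C_0[OF F field_continuous]
        test_function_orbit_derivative[OF F], of "e / 2"] \<open>e > 0\<close> by auto
  obtain d2 where d2: "d2 > 0" "\<And>t z. 0 < t \<Longrightarrow> t \<le> d2 \<Longrightarrow>
      \<bar>(1 / t) * (f (\<phi> t z) - f z) - k z\<bar> \<le> e / 2"
    using orbit_difference_quotient[OF k, of "e / 2"] \<open>e > 0\<close> by auto
  have "((\<lambda>t. exp (L * t)) has_real_derivative L) (at 0)"
    by (auto intro!: derivative_eq_intros)
  then have "((\<lambda>t. (exp (L * t) - 1) / t) \<longlongrightarrow> L) (at 0)"
    by (simp add: DERIV_def)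
  from order_tendstoD(2)[OF this, of "L + 1"]
  obtain d3 where d3: "d3 > 0" "\<And>t. 0 < t \<Longrightarrow> t < d3 \<Longrightarrow> (exp (L * t) - 1) / t < L + 1"
    by (auto simp: eventually_at)
  define t where "t = min d1 (min d2 (d3 / 2))"
  have t: "0 < t" "t \<le> d1" "t \<le> d2" "t < d3" using d1(1) d2(1) d3(1) by (auto simp: t_def)
  define u where "u y = (1 / t) * (f (\<phi> t z - y) - f (z - y)) - k (z - y)" for y
  have cu: "continuous_on UNIV u"
    unfolding u_def
    by (intro continuous_intros continuous_on_compose2[OF cf] continuous_on_compose2[OF ck]) auto
  have ub: "\<bar>u y\<bar> \<le> M * (L + 1) * \<epsilon> + e / 2" if y: "norm y < \<epsilon>" for y
  proof -
    have "norm (\<phi> t z - y - \<phi> t (z - y)) \<le> (exp (L * t) - 1) * norm y"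
      using flow_almost_commutes_with_translation[of t z "z - y"] t
      by (simp add: algebra_simps)
    also have "\<dots> \<le> t * (L + 1) * \<epsilon>"
      using d3(2)[of t] t y L_pos by (intro mult_mono) (auto simp: divide_simps mult.commute)
    finally have "\<bar>f (\<phi> t z - y) - f (\<phi> t (z - y))\<bar> \<le> M * (t * (L + 1) * \<epsilon>)"
      using M(1) by (intro order_trans[OF M(2)]) auto
    then have "(1 / t) * \<bar>f (\<phi> t z - y) - f (\<phi> t (z - y))\<bar> \<le> (1 / t) * (M * (t * (L + 1) * \<epsilon>))"
      using t by (intro mult_left_mono) auto
    then have "\<bar>(1 / t) * (f (\<phi> t z - y) - f (\<phi> t (z - y)))\<bar> \<le> M * (L + 1) * \<epsilon>"
      using t by (simp add: abs_mult)
    moreover have "u y = (1 / t) * (f (\<phi> t z - y) - f (\<phi> t (z - y))) +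
        ((1 / t) * (f (\<phi> t (z - y)) - f (z - y)) - k (z - y))"
      by (simp add: u_def algebra_simps)
    ultimately show ?thesis using d2(2)[of t "z - y"] t by linarith
  qed
  have int: "integrable lborel (\<lambda>y. f (x - y) * \<rho> y)" "integrable lborel (\<lambda>y. k (x - y) * \<rho> y)" for x
    by (intro mollifier_average(1)[OF \<rho>(1)] continuous_on_compose2[OF cf] continuous_on_compose2[OF ck];
        auto intro!: continuous_intros)+
  have "(\<integral>y. u y * \<rho> y \<partial>lborel) =
      (\<integral>y. (1 / t) * (f (\<phi> t z - y) * \<rho> y - f (z - y) * \<rho> y) - k (z - y) * \<rho> y \<partial>lborel)"
    by (simp add: u_def algebra_simps)
  also have "\<dots> = (1 / t) * (?F (\<phi> t z) - ?F z) - mollify \<rho> k z"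
    using int by (simp add: mollify_def)
  finally have "\<bar>(1 / t) * (?F (\<phi> t z) - ?F z) - mollify \<rho> k z\<bar> \<le> M * (L + 1) * \<epsilon> + e / 2"
    using mollifier_average(2)[OF \<rho>(1) cu ub] by simp
  moreover have "\<bar>(1 / t) * (?F (\<phi> t z) - ?F z) - lie_derivative g ?F z\<bar> \<le> e / 2"
    using d1(2)[of t z] t by blast
  ultimately show "\<bar>lie_derivative g ?F z - mollify \<rho> k z\<bar> \<le> M * (L + 1) * \<epsilon> + e"
    by linarith
qed

text \<open>Solve the equation for a test function \<open>h'\<close> near \<open>h\<close> and mollify the solution \<open>f\<close>. It is
  Lipschitz because \<open>\<nu>\<close> exceeds the expansion rate \<open>L\<close> of the flow, and it has bounded support
  because orbits from far away never meet the support of \<open>h'\<close>.\<close>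

lemma resolvent_equation_approx:
  assumes confined: "\<And>R. \<exists>S. \<forall>z t. norm z > S \<longrightarrow> norm (\<phi> t z) > R"
    and "\<nu> > L" "h \<in> C_0" "\<And>z. \<bar>h z\<bar> \<le> B" "\<eta> > 0"
  shows "\<exists>F\<in>Cc_infty. (\<forall>z. \<bar>\<nu> * F z - lie_derivative g F z - h z\<bar> \<le> \<eta>) \<and> (\<forall>z. \<bar>F z\<bar> \<le> (B + \<eta>) / \<nu>)"
proof -
  have \<nu>: "\<nu> > 0" using assms L_pos by simp
  obtain h' where h': "h' \<in> Cc_infty" "\<And>z. \<bar>h' z - h z\<bar> \<le> \<eta> / 2"
    using Cc_infty_dense[OF \<open>h \<in> C_0\<close>, of "\<eta> / 2"] \<open>\<eta> > 0\<close> by auto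
  have h'0: "h' \<in> C_0" by (rule Cc_infty_in_C_0[OF h'(1)])
  have ch': "continuous_on UNIV h'" using h'0 by (simp add: C_0_def)
  have h'b: "\<bar>h' z\<bar> \<le> B + \<eta>" for z
    using h'(2)[of z] assms(4)[of z] \<open>\<eta> > 0\<close> by linarith
  obtain M where M: "M > 0" "\<And>x y. \<bar>h' x - h' y\<bar> \<le> M * norm (x - y)"
    using Cc_infty_lipschitz[OF h'(1)] by blast
  define f where "f = resolvent \<nu> h'"
  define N where "N = M / (\<nu> - L)"
  have N: "N > 0" "\<And>x y. \<bar>f x - f y\<bar> \<le> N * norm (x - y)"
    using M \<open>\<nu> > L\<close> resolvent_lipschitz[OF \<nu> ch' h'b \<open>\<nu> > L\<close> M] by (auto simp: f_def N_def)
  have "N-lipschitz_on UNIV f" using N by (intro lipschitz_onI) (auto simp: dist_norm)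
  then have cf: "continuous_on UNIV f" by (rule lipschitz_on_continuous_on)
  obtain R where R: "\<And>z. norm z > R \<Longrightarrow> h' z = 0" using Cc_infty_vanishes[OF h'(1)] by blast
  obtain S where S: "\<And>z t. norm z > S \<Longrightarrow> norm (\<phi> t z) > R" using confined by blast
  have f0: "f z = 0" if "norm z > S" for z
    unfolding f_def resolvent_def using R[OF S[OF that]] by simp
  have fC: "f \<in> C_0" by (rule C_0_I[OF cf f0])
  define k where "k z = \<nu> * f z - h' z" for z
  have k: "k \<in> C_0" unfolding k_def by (intro C_0_diff C_0_scale fC h'0)
  have der: "((\<lambda>s. f (\<phi> s z)) has_real_derivative k (\<phi> s z)) (at s)" for z s
    unfolding f_def k_def by (rule resolvent_orbit_derivative[OF \<nu> ch' h'b])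
  \<comment> \<open>The error is at most \<open>\<nu> e\<close> from \<open>?F\<close>, \<open>2 e\<close> from its derivative and \<open>\<eta> / 2\<close> from \<open>h'\<close>.\<close>
  define e where "e = \<eta> / 2 / (\<nu> + 2)"
  have e: "e > 0" "(\<nu> + 2) * e = \<eta> / 2" using \<open>\<eta> > 0\<close> \<nu> nonzero_mult_div_cancel_left[of "\<nu> + 2" "\<eta> / 2"]
    by (simp_all add: e_def del: divide_divide_eq_left)
  obtain d1 where d1: "d1 > 0" "\<And>x y. norm (x - y) < d1 \<Longrightarrow> \<bar>f x - f y\<bar> \<le> e"
    using C_0_uniformly_continuous[OF fC e(1)] by metis
  obtain d2 where d2: "d2 > 0" "\<And>x y. norm (x - y) < d2 \<Longrightarrow> \<bar>k x - k y\<bar> \<le> e"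
    using C_0_uniformly_continuous[OF k e(1)] by metis
  define \<epsilon> where "\<epsilon> = min (min d1 d2) (e / (N * (L + 1)))"
  have \<epsilon>: "\<epsilon> > 0" "\<epsilon> \<le> d1" "\<epsilon> \<le> d2" "N * (L + 1) * \<epsilon> \<le> e"
  proof -
    have "N * (L + 1) > 0" using N L_pos by simp
    moreover have "\<epsilon> \<le> e / (N * (L + 1))" by (simp add: \<epsilon>_def)
    ultimately show "N * (L + 1) * \<epsilon> \<le> e"
      by (simp only: pos_le_divide_eq mult.commute)
    show "\<epsilon> > 0" using d1(1) d2(1) e(1) N(1) L_pos by (simp add: \<epsilon>_def)
  qed (auto simp: \<epsilon>_def)
  obtain \<rho> :: "'b \<Rightarrow> real" where \<rho>: "mollifier \<epsilon> \<rho>" using mollifier_exists[OF \<epsilon>(1)] by blast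
  let ?F = "mollify \<rho> f"
  have 1: "\<bar>?F z - f z\<bar> \<le> e" for z
    by (rule mollify_near[OF \<rho> cf]) (use d1(2) \<epsilon> in auto)
  have 2: "\<bar>mollify \<rho> k z - k z\<bar> \<le> e" for z
    by (rule mollify_near[OF \<rho>]) (use d2(2) \<epsilon> k in \<open>auto simp: C_0_def\<close>)
  have 3: "\<bar>lie_derivative g ?F z - mollify \<rho> k z\<bar> \<le> e" for z
    by (rule order_trans[OF mollify_orbit_derivative[OF \<rho> \<epsilon>(1) f0 N k der] \<epsilon>(4)])
  have "\<bar>\<nu> * ?F z - lie_derivative g ?F z - h z\<bar> \<le> \<eta>" for z
  proof -
    have "\<bar>\<nu> * (?F z - f z)\<bar> \<le> \<nu> * e" using 1[of z] \<nu> by (simp add: abs_mult)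
    moreover have eq: "\<nu> * ?F z - lie_derivative g ?F z - h z = \<nu> * (?F z - f z) -
        (mollify \<rho> k z - k z) - (lie_derivative g ?F z - mollify \<rho> k z) + (h' z - h z)"
      by (simp add: k_def algebra_simps)
    moreover have "\<nu> * e + 2 * e = \<eta> / 2" using e(2) by (simp add: algebra_simps)
    ultimately show ?thesis using 2[of z] 3[of z] h'(2)[of z] unfolding eq by linarith
  qed
  moreover have "\<bar>?F z - 0\<bar> \<le> (B + \<eta>) / \<nu>" for z
    using resolvent_bound[OF \<nu> ch' h'b] by (intro mollify_near[OF \<rho> cf]) (auto simp: f_def)
  moreover have "?F \<in> Cc_infty" by (rule mollify_Cc_infty[OF \<rho> cf f0])
  ultimately show ?thesis by auto
qed

end

section \<open>Generators of contraction families and their cores\<close>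

lemma sup_norm_le: "(\<And>z. \<bar>f z\<bar> \<le> B) \<Longrightarrow> sup_norm f \<le> B"
  unfolding sup_norm_def by (rule cSUP_least) auto

lemma le_sup_norm: "(\<And>z. \<bar>f z\<bar> \<le> B) \<Longrightarrow> \<bar>f z\<bar> \<le> sup_norm f"
  unfolding sup_norm_def by (rule cSUP_upper) (auto intro: bdd_aboveI[of _ B])

lemma sup_norm_nonneg: "(\<And>z. \<bar>f z\<bar> \<le> B) \<Longrightarrow> 0 \<le> sup_norm f"
  using le_sup_norm[of f B] abs_ge_zero order_trans by blast

lemma sup_norm_at_right_zeroI:
  assumes "\<And>e. e > 0 \<Longrightarrow> \<exists>d>0. \<forall>t z. 0 < t \<and> t \<le> d \<longrightarrow> \<bar>D t z\<bar> \<le> e"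
  shows "((\<lambda>t. sup_norm (D t)) \<longlongrightarrow> 0) (at_right (0::real))"
proof (rule tendstoI)
  fix e :: real assume "e > 0"
  then obtain d where d: "d > 0" "\<And>t z. 0 < t \<Longrightarrow> t \<le> d \<Longrightarrow> \<bar>D t z\<bar> \<le> e / 2"
    using assms[of "e / 2"] by auto
  have "dist (sup_norm (D t)) 0 < e" if "0 < t" "t < d" for t
    using sup_norm_le[of "D t" "e / 2"] sup_norm_nonneg[of "D t" "e / 2"] d(2) that \<open>e > 0\<close> by simp
  then show "eventually (\<lambda>t. dist (sup_norm (D t)) 0 < e) (at_right 0)"
    using d(1) by (auto simp: eventually_at_right_field)
qed

lemma sup_norm_sequentially_zeroI:
  assumes "\<And>n z. \<bar>D n z\<bar> \<le> b n" "b \<longlonglongrightarrow> (0::real)"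
  shows "(\<lambda>n. sup_norm (D n)) \<longlonglongrightarrow> 0"
proof (rule Lim_null_comparison[OF _ assms(2)])
  show "eventually (\<lambda>n. norm (sup_norm (D n)) \<le> b n) sequentially"
    using sup_norm_le[of "D n" "b n" for n] sup_norm_nonneg[of "D n" "b n" for n] assms(1)
    by (intro always_eventually allI) (simp add: abs_of_nonneg)
qed

locale contraction_family =
  fixes P :: "real \<Rightarrow> ('b::euclidean_space \<Rightarrow> real) \<Rightarrow> 'b \<Rightarrow> real"
  assumes preserves_C_0: "t \<ge> 0 \<Longrightarrow> f \<in> C_0 \<Longrightarrow> P t f \<in> C_0"
    and contraction: "t \<ge> 0 \<Longrightarrow> f \<in> C_0 \<Longrightarrow> (\<And>z. \<bar>f z\<bar> \<le> B) \<Longrightarrow> \<bar>P t f z\<bar> \<le> B"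
    and diff: "t \<ge> 0 \<Longrightarrow> f \<in> C_0 \<Longrightarrow> h \<in> C_0 \<Longrightarrow> P t (\<lambda>z. f z - h z) z = P t f z - P t h z"
begin

lemma generator_limit_uniform:
  assumes "is_generator_limit P f h" "f \<in> C_0" "e > 0"
  obtains d where "d > 0" "\<And>t z. 0 < t \<Longrightarrow> t < d \<Longrightarrow> \<bar>(1 / t) * (P t f z - f z) - h z\<bar> \<le> e"
proof -
  let ?D = "\<lambda>t z. (1 / t) * (P t f z - f z) - h z"
  have h: "h \<in> C_0" and "((\<lambda>t. sup_norm (?D t)) \<longlongrightarrow> 0) (at_right 0)"
    using assms(1) by (auto simp: is_generator_limit_def)
  from tendstoD[OF this(2) \<open>e > 0\<close>] obtain d where d: "d > 0"
    "\<And>t. 0 < t \<Longrightarrow> t < d \<Longrightarrow> \<bar>sup_norm (?D t)\<bar> < e"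
    by (auto simp: eventually_at_right_field)
  have "\<bar>?D t z\<bar> \<le> e" if t: "0 < t" "t < d" for t z
  proof -
    have "?D t \<in> C_0"
      using t by (intro C_0_diff C_0_scale preserves_C_0 assms h) auto
    then obtain B where "\<And>z. \<bar>?D t z\<bar> \<le> B" using C_0_bounded by blast
    from le_sup_norm[of "?D t" B z, OF this] d(2)[OF t] show ?thesis by linarith
  qed
  then show ?thesis using that d(1) by blast
qed

lemma generator_limit_diff:
  assumes "is_generator_limit P f h" "is_generator_limit P f' h'" "f \<in> C_0" "f' \<in> C_0"
  shows "is_generator_limit P (\<lambda>z. f z - f' z) (\<lambda>z. h z - h' z)"
  unfolding is_generator_limit_def
proof (intro conjI sup_norm_at_right_zeroI)
  show "(\<lambda>z. h z - h' z) \<in> C_0" using assms by (auto simp: is_generator_limit_def intro: C_0_diff)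
  fix e :: real assume "e > 0"
  then have e2: "e / 2 > 0" by simp
  obtain d where d: "d > 0" "\<And>t z. 0 < t \<Longrightarrow> t < d \<Longrightarrow> \<bar>(1 / t) * (P t f z - f z) - h z\<bar> \<le> e / 2"
    using generator_limit_uniform[OF assms(1,3) e2] by metis
  obtain d' where d': "d' > 0" "\<And>t z. 0 < t \<Longrightarrow> t < d' \<Longrightarrow> \<bar>(1 / t) * (P t f' z - f' z) - h' z\<bar> \<le> e / 2"
    using generator_limit_uniform[OF assms(2,4) e2] by metis
  have "\<bar>(1 / t) * (P t (\<lambda>z. f z - f' z) z - (f z - f' z)) - (h z - h' z)\<bar> \<le> e"
    if t: "0 < t" "t \<le> min d d' / 2" for t z
  proof -
    have "P t (\<lambda>z. f z - f' z) z = P t f z - P t f' z"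
      using t by (intro diff assms) auto
    then have eq: "(1 / t) * (P t (\<lambda>z. f z - f' z) z - (f z - f' z)) - (h z - h' z) =
        ((1 / t) * (P t f z - f z) - h z) - ((1 / t) * (P t f' z - f' z) - h' z)"
      by (simp only: right_diff_distrib)
    have "t < d" "t < d'" using t d(1) d'(1) by auto
    with t d(2)[of t z] d'(2)[of t z] show ?thesis unfolding eq by linarith
  qed
  then show "\<exists>d>0. \<forall>t z. 0 < t \<and> t \<le> d \<longrightarrow>
      \<bar>(1 / t) * (P t (\<lambda>z. f z - f' z) z - (f z - f' z)) - (h z - h' z)\<bar> \<le> e"
    using d(1) d'(1) by (intro exI[of _ "min d d' / 2"]) auto
qed

text \<open>Dissipativity. In \<open>\<mu> f - (P t f - f) / t\<close> the function \<open>f\<close> appears with the factor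
  \<open>\<mu> + 1 / t\<close>, while \<open>P t f / t\<close> has norm at most \<open>1 / t\<close> times that of \<open>f\<close>.\<close>

lemma dissipative:
  assumes lim: "is_generator_limit P f h" and f: "f \<in> C_0"
    and "\<mu> > 0" and c: "\<And>z. \<bar>\<mu> * f z - h z\<bar> \<le> c"
  shows "\<bar>f z\<bar> \<le> c / \<mu>"
proof -
  obtain B where B: "\<And>z. \<bar>f z\<bar> \<le> B" using C_0_bounded[OF f] by blast
  define S where "S = sup_norm f"
  have S: "\<bar>f z\<bar> \<le> S" for z unfolding S_def by (rule le_sup_norm[OF B])
  have "\<mu> * S \<le> c"
  proof (rule field_le_epsilon)
    fix e :: real assume "e > 0"
    obtain d where d: "d > 0" "\<And>t z. 0 < t \<Longrightarrow> t < d \<Longrightarrow> \<bar>(1 / t) * (P t f z - f z) - h z\<bar> \<le> e"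
      using generator_limit_uniform[OF lim f \<open>e > 0\<close>] by blast
    define t where "t = d / 2"
    have t: "0 < t" "t < d" using d(1) by (auto simp: t_def)
    have "\<bar>f z\<bar> \<le> (S / t + c + e) / (1 / t + \<mu>)" for z
    proof -
      have "\<bar>P t f z\<bar> \<le> S" using t by (intro contraction f S) auto
      then have "\<bar>(1 / t) * P t f z\<bar> \<le> S / t" using t by (simp add: abs_mult divide_right_mono)
      moreover have "(1 / t + \<mu>) * f z = (1 / t) * P t f z + (\<mu> * f z - h z)
          - ((1 / t) * (P t f z - f z) - h z)"
        by (simp add: algebra_simps)
      ultimately have "\<bar>(1 / t + \<mu>) * f z\<bar> \<le> S / t + c + e"
        using c[of z] d(2)[OF t, of z] by linarith
      moreover have "1 / t + \<mu> > 0" using t \<open>\<mu> > 0\<close> by (simp add: add_pos_pos)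
      ultimately show ?thesis by (simp add: abs_mult pos_le_divide_eq mult.commute)
    qed
    then have "S \<le> (S / t + c + e) / (1 / t + \<mu>)" unfolding S_def by (rule sup_norm_le)
    moreover have "1 / t + \<mu> > 0" using t \<open>\<mu> > 0\<close> by (simp add: add_pos_pos)
    ultimately have "S * (1 / t + \<mu>) \<le> S / t + c + e" by (simp only: pos_le_divide_eq)
    then show "\<mu> * S \<le> c + e" by (simp add: algebra_simps)
  qed
  moreover have "\<mu> * \<bar>f z\<bar> \<le> \<mu> * S" using S[of z] \<open>\<mu> > 0\<close> by (intro mult_left_mono) auto
  ultimately have "\<bar>f z\<bar> * \<mu> \<le> c" by (simp only: mult.commute)
  then show ?thesis using \<open>\<mu> > 0\<close> by (simp add: pos_le_divide_eq mult.commute)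
qed

lemma generator_eqI:
  assumes "is_generator_limit P f h" "f \<in> C_0"
  shows "generator P f = h"
  unfolding generator_def
proof (rule the_equality, rule assms(1))
  fix h' assume "is_generator_limit P f h'"
  from generator_limit_diff[OF this assms(1) assms(2) assms(2)]
  have lim: "is_generator_limit P (\<lambda>z. 0) (\<lambda>z. h' z - h z)" by simp
  have 0: "(\<lambda>z. 0) \<in> C_0" by (simp add: C_0_def)
  have P0: "P t (\<lambda>z. 0) z = 0" if "t \<ge> 0" for t z
    using contraction[OF that 0, of 0 z] by simp
  have "\<bar>h' z - h z\<bar> \<le> 0" for z
  proof (rule field_le_epsilon)
    fix e :: real assume "e > 0"
    obtain d where "d > 0" "\<And>t z. 0 < t \<Longrightarrow> t < d \<Longrightarrow> \<bar>(1 / t) * (P t (\<lambda>z. 0) z - 0) - (h' z - h z)\<bar> \<le> e"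
      using generator_limit_uniform[OF lim 0 \<open>e > 0\<close>] by blast
    from this(2)[of "d / 2" z] this(1) show "\<bar>h' z - h z\<bar> \<le> 0 + e" by (simp add: P0 abs_minus_commute)
  qed
  then show "h' = h" by (auto simp: fun_eq_iff)
qed

text \<open>If \<open>\<mu> - A\<close> has dense range on \<open>E\<close>, approximate \<open>\<mu> f - A f\<close> by \<open>\<mu> F - A F\<close> with \<open>F \<in> E\<close>;
  by dissipativity \<open>F\<close> is then close to \<open>f\<close>, and so is \<open>A F\<close> to \<open>A f\<close>.\<close>

lemma core_if_dense_range:
  assumes E: "E \<subseteq> C_0" "\<And>F. F \<in> E \<Longrightarrow> is_generator_limit P F (A F)" and "\<mu> > 0"
    and dense: "\<And>h e. h \<in> C_0 \<Longrightarrow> e > 0 \<Longrightarrow> \<exists>F\<in>E. \<forall>z. \<bar>\<mu> * F z - A F z - h z\<bar> \<le> e"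
  shows "is_core_of_generator E P"
  unfolding is_core_of_generator_def
proof (intro conjI ballI)
  show "E \<subseteq> generator_dom P" using E by (auto simp: generator_dom_def)
  fix f assume "f \<in> generator_dom P"
  then obtain h where f: "f \<in> C_0" and lim: "is_generator_limit P f h"
    by (auto simp: generator_dom_def)
  have gen: "generator P f = h" by (rule generator_eqI[OF lim f])
  have "(\<lambda>z. \<mu> * f z - h z) \<in> C_0"
    using lim by (intro C_0_diff C_0_scale f) (auto simp: is_generator_limit_def)
  then have "\<forall>n. \<exists>F\<in>E. \<forall>z. \<bar>\<mu> * F z - A F z - (\<mu> * f z - h z)\<bar> \<le> inverse (real (Suc n))"
    by (intro allI dense) auto
  then obtain F where F: "\<And>n. F n \<in> E"
    "\<And>n z. \<bar>\<mu> * F n z - A (F n) z - (\<mu> * f z - h z)\<bar> \<le> inverse (real (Suc n))"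
    by metis
  have F0: "F n \<in> C_0" for n using F E by blast
  have genF: "generator P (F n) = A (F n)" for n by (rule generator_eqI[OF E(2)[OF F(1)] F0])
  have 1: "\<bar>F n z - f z\<bar> \<le> inverse (real (Suc n)) / \<mu>" for n z
  proof (rule dissipative[OF generator_limit_diff[OF E(2)[OF F(1)] lim F0 f] C_0_diff[OF F0 f] \<open>\<mu> > 0\<close>])
    fix z
    show "\<bar>\<mu> * (F n z - f z) - (A (F n) z - h z)\<bar> \<le> inverse (real (Suc n))"
      using F(2)[of n z] by (simp add: algebra_simps)
  qed
  have 2: "\<bar>A (F n) z - h z\<bar> \<le> 2 * inverse (real (Suc n))" for n z
  proof -
    have "\<bar>\<mu> * (F n z - f z)\<bar> \<le> inverse (real (Suc n))"
      using 1[of n z] \<open>\<mu> > 0\<close> by (simp add: abs_mult pos_le_divide_eq mult.commute)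
    moreover have "A (F n) z - h z =
        \<mu> * (F n z - f z) - (\<mu> * F n z - A (F n) z - (\<mu> * f z - h z))"
      by (simp add: algebra_simps)
    ultimately show ?thesis using F(2)[of n z] by linarith
  qed
  show "\<exists>F. (\<forall>n. F n \<in> E) \<and> (\<lambda>n. sup_norm (\<lambda>z. F n z - f z)) \<longlonglongrightarrow> 0 \<and>
      (\<lambda>n. sup_norm (\<lambda>z. generator P (F n) z - generator P f z)) \<longlonglongrightarrow> 0"
  proof (intro exI conjI allI)
    show "F n \<in> E" for n by (rule F)
    have "(\<lambda>n. inverse (real (Suc n)) / \<mu>) \<longlonglongrightarrow> 0 / \<mu>"
      using \<open>\<mu> > 0\<close> by (intro tendsto_intros LIMSEQ_inverse_real_of_nat) auto
    then show "(\<lambda>n. sup_norm (\<lambda>z. F n z - f z)) \<longlonglongrightarrow> 0"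
      by (intro sup_norm_sequentially_zeroI[OF 1]) simp
    have "(\<lambda>n. 2 * inverse (real (Suc n))) \<longlonglongrightarrow> 2 * 0"
      by (intro tendsto_intros LIMSEQ_inverse_real_of_nat)
    then show "(\<lambda>n. sup_norm (\<lambda>z. generator P (F n) z - generator P f z)) \<longlonglongrightarrow> 0"
      unfolding gen genF by (intro sup_norm_sequentially_zeroI[OF 2]) simp
  qed
qed

end

text \<open>Reducing the residual by a fixed factor is enough: solve again for the residual and add.\<close>

lemma dense_range_if_residual_shrinks:
  assumes TC: "\<And>F. F \<in> E \<Longrightarrow> T F \<in> C_0"
    and add: "\<And>F G. F \<in> E \<Longrightarrow> G \<in> E \<Longrightarrow> (\<lambda>z. F z + G z) \<in> E"
      "\<And>F G z. F \<in> E \<Longrightarrow> G \<in> E \<Longrightarrow> T (\<lambda>z. F z + G z) z = T F z + T G z"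
    and \<theta>: "0 < \<theta>" "\<theta> < 1"
    and step: "\<And>h B. h \<in> C_0 \<Longrightarrow> B > 0 \<Longrightarrow> (\<And>z. \<bar>h z\<bar> \<le> B) \<Longrightarrow> \<exists>F\<in>E. \<forall>z. \<bar>T F z - h z\<bar> \<le> \<theta> * B"
    and h: "h \<in> C_0" and "e > 0"
  shows "\<exists>F\<in>E. \<forall>z. \<bar>T F z - h z\<bar> \<le> e"
proof -
  obtain B where B: "B > 0" "\<And>z. \<bar>h z\<bar> \<le> B" using C_0_bounded[OF h] by blast
  have iter: "\<exists>F\<in>E. \<forall>z. \<bar>T F z - h z\<bar> \<le> \<theta> ^ Suc n * B" for n
  proof (induction n)
    case 0
    then show ?case using step[OF h B] by simp
  next
    case (Suc n)
    then obtain F where F: "F \<in> E" "\<And>z. \<bar>T F z - h z\<bar> \<le> \<theta> ^ Suc n * B" by blast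
    have "\<exists>G\<in>E. \<forall>z. \<bar>T G z - (h z - T F z)\<bar> \<le> \<theta> * (\<theta> ^ Suc n * B)"
    proof (rule step)
      show "(\<lambda>z. h z - T F z) \<in> C_0" by (intro C_0_diff h TC F)
      show "\<bar>h z - T F z\<bar> \<le> \<theta> ^ Suc n * B" for z using F(2)[of z] by (simp add: abs_minus_commute)
    qed (use \<theta> B in simp)
    then obtain G where G: "G \<in> E" "\<And>z. \<bar>T G z - (h z - T F z)\<bar> \<le> \<theta> * (\<theta> ^ Suc n * B)" by blast
    have "\<bar>T (\<lambda>z. F z + G z) z - h z\<bar> \<le> \<theta> ^ Suc (Suc n) * B" for z
      using G(2)[of z] by (simp add: add(2)[OF F(1) G(1)] algebra_simps)
    then show ?case using add(1)[OF F(1) G(1)] by blast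
  qed
  have "(\<lambda>n. \<theta> ^ Suc n * B) \<longlonglongrightarrow> 0 * B"
    using LIMSEQ_Suc[OF LIMSEQ_power_zero[of \<theta>]] \<theta> by (intro tendsto_intros) auto
  from order_tendstoD(2)[OF this, of e] obtain n where "\<theta> ^ Suc n * B < e"
    using \<open>e > 0\<close> by (auto simp: eventually_sequentially)
  then show ?thesis using iter[of n] by (meson less_imp_le order_trans)
qed

section \<open>The process as a random proper map\<close>

text \<open>Both \<open>P_t f\<close> and the refreshment average are of the form \<open>z \<mapsto> E f (X z)\<close> with a random
  continuous map \<open>X\<close> that sends infinity to infinity, and dominated convergence applies to each
  sequence of points.\<close>

lemma C_0_average:
  fixes X :: "'c \<Rightarrow> 'b::euclidean_space \<Rightarrow> 'b"
  assumes "prob_space M" and f: "f \<in> C_0"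
    and meas: "\<And>z. (\<lambda>\<omega>. X \<omega> z) \<in> borel_measurable M"
    and cont: "\<And>\<omega>. continuous_on UNIV (X \<omega>)"
    and proper: "\<And>\<omega>. filterlim (X \<omega>) at_infinity at_infinity"
  shows "(\<lambda>z. \<integral>\<omega>. f (X \<omega> z) \<partial>M) \<in> C_0"
proof -
  interpret prob_space M by fact
  obtain B where B: "\<And>z. \<bar>f z\<bar> \<le> B" using C_0_bounded[OF f] by blast
  have cf: "continuous_on UNIV f" and f0: "(f \<longlongrightarrow> 0) at_infinity" using f by (auto simp: C_0_def)
  have mf: "(\<lambda>\<omega>. f (X \<omega> z)) \<in> borel_measurable M" for z
    by (rule measurable_compose[OF meas borel_measurable_continuous_onI[OF cf]])
  have dc: "(\<lambda>n. \<integral>\<omega>. f (X \<omega> (u n)) \<partial>M) \<longlonglongrightarrow> (\<integral>\<omega>. l \<omega> \<partial>M)"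
    if "\<And>\<omega>. (\<lambda>n. f (X \<omega> (u n))) \<longlonglongrightarrow> l \<omega>" "l \<in> borel_measurable M" for u l
    by (rule integral_dominated_convergence[where w = "\<lambda>_. B"]) (use that mf B in auto)
  have "continuous_on UNIV (\<lambda>z. \<integral>\<omega>. f (X \<omega> z) \<partial>M)"
  proof (rule continuous_on_sequentiallyI)
    fix u :: "nat \<Rightarrow> 'b" and a assume u: "u \<longlonglongrightarrow> a"
    show "(\<lambda>n. \<integral>\<omega>. f (X \<omega> (u n)) \<partial>M) \<longlonglongrightarrow> (\<integral>\<omega>. f (X \<omega> a) \<partial>M)"
    proof (rule dc[OF _ mf])
      fix \<omega>
      have "continuous_on UNIV (\<lambda>z. f (X \<omega> z))" by (rule continuous_on_compose2[OF cf cont]) simp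
      then show "(\<lambda>n. f (X \<omega> (u n))) \<longlonglongrightarrow> f (X \<omega> a)"
        by (rule continuous_on_tendsto_compose[OF _ u]) auto
    qed
  qed
  moreover have "((\<lambda>z. \<integral>\<omega>. f (X \<omega> z) \<partial>M) \<longlongrightarrow> 0) at_infinity"
  proof (rule ccontr)
    assume "\<not> ?thesis"
    then obtain e where e: "e > 0" "\<And>R. \<exists>z. norm z \<ge> R \<and> \<not> \<bar>\<integral>\<omega>. f (X \<omega> z) \<partial>M\<bar> < e"
      by (auto simp: tendsto_iff eventually_at_infinity)
    from e(2) have "\<forall>n. \<exists>z. norm z \<ge> real n \<and> \<not> \<bar>\<integral>\<omega>. f (X \<omega> z) \<partial>M\<bar> < e"
      by (intro allI)
    from choice[OF this] obtain u where u: "\<And>n. norm (u n) \<ge> real n" "\<And>n. \<not> \<bar>\<integral>\<omega>. f (X \<omega> (u n)) \<partial>M\<bar> < e"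
      by auto
    have "filterlim (\<lambda>n. norm (u n)) at_top sequentially"
      by (rule filterlim_at_top_mono[OF filterlim_real_sequentially]) (use u in auto)
    then have lim: "filterlim u at_infinity sequentially" by (rule filterlim_norm_at_top_imp_at_infinity)
    have "(\<lambda>n. f (X \<omega> (u n))) \<longlonglongrightarrow> 0" for \<omega>
      by (rule filterlim_compose[OF f0 filterlim_compose[OF proper lim]])
    then have "(\<lambda>n. \<integral>\<omega>. f (X \<omega> (u n)) \<partial>M) \<longlonglongrightarrow> (\<integral>\<omega>. 0 \<partial>M)" by (rule dc) simp
    then have "(\<lambda>n. \<integral>\<omega>. f (X \<omega> (u n)) \<partial>M) \<longlonglongrightarrow> 0" by simp
    from tendstoD[OF this e(1)] u(2) show False by (simp add: eventually_sequentially)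
  qed
  ultimately show ?thesis by (simp add: C_0_def)
qed

section \<open>The noise\<close>

lemma prob_space_std_gaussian: "prob_space (std_gaussian :: 'a::euclidean_space measure)"
proof
  have "(\<integral>\<^sup>+x. ennreal (std_normal_density x) \<partial>lborel) = 1"
  proof -
    interpret prob_space "density lborel (\<lambda>x. ennreal (std_normal_density x))"
      by (rule prob_space_normal_density) simp
    show ?thesis using emeasure_space_1 by (simp add: emeasure_density)
  qed
  then have "(\<integral>\<^sup>+x. (\<Prod>b\<in>Basis. ennreal (std_normal_density (x \<bullet> b))) \<partial>(lborel :: 'a measure)) = 1"
    by (subst nn_integral_lborel_prod) auto
  then show "emeasure (std_gaussian :: 'a measure) (space std_gaussian) = 1"
    by (simp add: std_gaussian_def emeasure_density prod_ennreal)
qed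

lemma sets_std_gaussian [simp, measurable_cong]: "sets std_gaussian = sets borel"
  by (simp add: std_gaussian_def)

lemma space_std_gaussian [simp]: "space std_gaussian = UNIV"
  by (simp add: std_gaussian_def)

abbreviation waiting_time :: "real \<Rightarrow> real measure" where
  "waiting_time r \<equiv> density lborel (exponential_density r)"

locale rhmc = lipschitz_field "ham_field U" L
  for U :: "'a::euclidean_space \<Rightarrow> real" and L +
  fixes r \<alpha> :: real
  assumes r_pos: "r > 0" and \<alpha>_pos: "\<alpha> > 0"
begin

abbreviation jump_noise :: "(real \<times> 'a) measure" where
  "jump_noise \<equiv> waiting_time r \<Otimes>\<^sub>M std_gaussian"

abbreviation noise :: "(nat \<Rightarrow> real \<times> 'a) measure" where
  "noise \<equiv> rhmc_noise r"

sublocale W: prob_space "waiting_time r"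
  by (rule prob_space_exponential_density[OF r_pos])

sublocale G: prob_space "std_gaussian :: 'a measure"
  by (rule prob_space_std_gaussian)

sublocale WG: pair_prob_space "waiting_time r" "std_gaussian :: 'a measure" ..

sublocale N: product_prob_space "\<lambda>_. jump_noise" "UNIV :: nat set" ..

lemma noise_eq: "noise = Pi\<^sub>M UNIV (\<lambda>_. jump_noise)"
  by (simp add: rhmc_noise_def)

sublocale noise: prob_space noise
  unfolding noise_eq by unfold_locales

lemma noise_component_measurable:
  "(\<lambda>\<omega>. \<omega> n) \<in> noise \<rightarrow>\<^sub>M jump_noise"
  unfolding noise_eq by (rule measurable_component_singleton) simp

lemma waiting_time_measurable [measurable]: "(\<lambda>\<omega>. fst (\<omega> n)) \<in> borel_measurable noise"
  using measurable_compose[OF noise_component_measurable measurable_fst] by simp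

lemma refreshment_measurable [measurable]: "(\<lambda>\<omega>. snd (\<omega> n)) \<in> borel_measurable noise"
  using measurable_compose[OF noise_component_measurable measurable_snd]
  by (simp add: measurable_cong_sets[OF refl sets_std_gaussian])

lemma jump_time_measurable [measurable]: "(\<lambda>\<omega>. jump_time \<omega> n) \<in> borel_measurable noise"
  unfolding jump_time_def by measurable

lemma num_jumps_measurable: "(\<lambda>\<omega>. num_jumps \<omega> t) \<in> noise \<rightarrow>\<^sub>M count_space UNIV"
  unfolding num_jumps_def by measurable

lemma ham_flow_eq: "ham_flow U = \<phi>"
  by (simp add: fun_eq_iff ham_flow_def flow_of_def)

lemma flow_measurable:
  assumes "s \<in> borel_measurable M" "x \<in> borel_measurable M"
  shows "(\<lambda>\<omega>. \<phi> (s \<omega>) (x \<omega>)) \<in> borel_measurable M"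
proof -
  have "(\<lambda>(t, z). \<phi> t z) \<in> borel_measurable borel"
    by (rule borel_measurable_continuous_onI[OF flow_jointly_continuous])
  from measurable_compose[OF _ this, of "\<lambda>\<omega>. (s \<omega>, x \<omega>)" M] assms show ?thesis
    by (simp add: borel_prod[symmetric])
qed

lemma refresh_jointly_continuous: "continuous_on UNIV (\<lambda>(\<xi> :: 'a, z). refresh \<alpha> \<xi> z)"
  unfolding refresh_def by (auto simp: case_prod_beta' intro!: continuous_intros)

lemma refresh_measurable:
  fixes s :: "'c \<Rightarrow> 'a"
  assumes "s \<in> borel_measurable M" "x \<in> borel_measurable M"
  shows "(\<lambda>\<omega>. refresh \<alpha> (s \<omega>) (x \<omega>)) \<in> borel_measurable M"
proof -
  have "(\<lambda>(\<xi> :: 'a, z). refresh \<alpha> \<xi> z) \<in> borel_measurable borel"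
    by (rule borel_measurable_continuous_onI[OF refresh_jointly_continuous])
  from measurable_compose[OF _ this, of "\<lambda>\<omega>. (s \<omega>, x \<omega>)" M] assms show ?thesis
    by (simp add: borel_prod[symmetric])
qed

lemma post_jump_state_measurable:
  "(\<lambda>\<omega>. post_jump_state U \<alpha> \<omega> z n) \<in> borel_measurable noise"
  by (induction n)
    (auto simp: ham_flow_eq intro!: refresh_measurable flow_measurable
      waiting_time_measurable refreshment_measurable)

lemma rhmc_process_measurable: "rhmc_process U \<alpha> z t \<in> borel_measurable noise"
proof -
  have "(\<lambda>\<omega>. \<phi> (t - jump_time \<omega> n) (post_jump_state U \<alpha> \<omega> z n)) \<in> borel_measurable noise" for n
    by (intro flow_measurable post_jump_state_measurable) measurable
  from measurable_compose_countable[OF this num_jumps_measurable]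
  show ?thesis by (simp add: rhmc_process_def[abs_def] ham_flow_eq Let_def)
qed

lemma refresh_continuous: "continuous_on UNIV (refresh \<alpha> (\<xi> :: 'a))"
  unfolding refresh_def by (auto simp: case_prod_beta' intro!: continuous_intros)

text \<open>For fixed \<open>\<xi>\<close> the factor \<open>\<alpha> > 0\<close> keeps a large momentum large. With \<open>\<alpha> = 0\<close> the old momentum
  would be forgotten, and averages would not vanish at infinity.\<close>

lemma refresh_proper: "filterlim (refresh \<alpha> (\<xi> :: 'a)) at_infinity at_infinity"
proof (rule filterlim_norm_at_top_imp_at_infinity)
  define m where "m = min 1 \<alpha>"
  have m: "m > 0" "m \<le> 1" "m \<le> \<alpha>" using \<alpha>_pos by (auto simp: m_def)
  define c where "c = norm (sqrt (1 - \<alpha>\<^sup>2) *\<^sub>R \<xi>)"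
  have le: "m / 2 * norm z - c \<le> norm (refresh \<alpha> \<xi> z)" for z :: "'a \<times> 'a"
  proof (cases z)
    case (Pair q p)
    have "norm z \<le> norm q + norm p" using norm_Pair_le[of q p] Pair by simp
    then have "m / 2 * norm z \<le> m / 2 * (norm q + norm p)"
      using m by (intro mult_left_mono) auto
    also have "\<dots> = (m * norm q + m * norm p) / 2" by (simp add: algebra_simps)
    also have "\<dots> \<le> (norm q + \<alpha> * norm p) / 2"
      using m mult_right_mono[of m 1 "norm q"] mult_right_mono[of m \<alpha> "norm p"] by simp
    finally have 1: "m / 2 * norm z \<le> (norm q + \<alpha> * norm p) / 2" .
    have "\<alpha> * norm p - c \<le> norm (\<alpha> *\<^sub>R p + sqrt (1 - \<alpha>\<^sup>2) *\<^sub>R \<xi>)"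
      using norm_triangle_ineq4[of "\<alpha> *\<^sub>R p + sqrt (1 - \<alpha>\<^sup>2) *\<^sub>R \<xi>" "sqrt (1 - \<alpha>\<^sup>2) *\<^sub>R \<xi>"] \<alpha>_pos
      by (simp add: c_def)
    moreover have "norm q \<le> norm (refresh \<alpha> \<xi> z)"
      "norm (\<alpha> *\<^sub>R p + sqrt (1 - \<alpha>\<^sup>2) *\<^sub>R \<xi>) \<le> norm (refresh \<alpha> \<xi> z)"
      by (simp_all add: refresh_def Pair norm_fst_le norm_snd_le norm_Pair real_le_rsqrt)
    moreover have "c \<ge> 0" by (simp add: c_def)
    moreover have "u - c \<le> w" if "a - c \<le> v" "b \<le> w" "v \<le> w" "0 \<le> c" "u \<le> (b + a) / 2"
      for a b u v w :: real
      using that by (simp add: field_simps)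
    ultimately show ?thesis using 1 by blast
  qed
  have "filterlim (\<lambda>z::'a \<times> 'a. norm z * (m / 2)) at_top at_infinity"
    using m by (intro filterlim_at_top_mult_tendsto_pos[OF tendsto_const] filterlim_norm_at_top) auto
  then have "filterlim (\<lambda>z::'a \<times> 'a. - c + norm z * (m / 2)) at_top at_infinity"
    by (rule filterlim_tendsto_add_at_top[OF tendsto_const])
  then show "filterlim (\<lambda>z. norm (refresh \<alpha> \<xi> z)) at_top at_infinity"
    by (rule filterlim_at_top_mono) (use le in \<open>simp add: mult.commute\<close>)
qed

lemma flow_filterlim: "filterlim (\<phi> t) at_infinity at_infinity"
proof (rule filterlim_norm_at_top_imp_at_infinity)
  show "filterlim (\<lambda>z. norm (\<phi> t z)) at_top at_infinity"
    unfolding filterlim_at_top_dense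
  proof
    fix R :: real
    obtain S where S: "\<And>s z. \<bar>s\<bar> \<le> \<bar>t\<bar> \<Longrightarrow> norm z > S \<Longrightarrow> norm (\<phi> s z) > R"
      using flow_proper by blast
    have "eventually (\<lambda>z::'a \<times> 'a. norm z \<ge> S + 1) at_infinity"
      by (auto simp: eventually_at_infinity)
    then show "eventually (\<lambda>z. R < norm (\<phi> t z)) at_infinity"
      by eventually_elim (rule S, auto)
  qed
qed

text \<open>The jump times do not depend on the initial point: for a fixed noise path, the state at a given
  time is a fixed composition of flow maps and refreshments.\<close>

lemma post_jump_state_continuous_proper:
  "continuous_on UNIV (\<lambda>z. post_jump_state U \<alpha> \<omega> z n) \<and>
    filterlim (\<lambda>z. post_jump_state U \<alpha> \<omega> z n) at_infinity at_infinity"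
proof (induction n)
  case (Suc n)
  then show ?case
    by (auto simp: ham_flow_eq intro!: continuous_on_compose2[OF refresh_continuous]
        continuous_on_compose2[OF flow_continuous] filterlim_compose[OF refresh_proper]
        filterlim_compose[OF flow_filterlim])
qed (auto simp: filterlim_ident)

lemma semigroup_C_0:
  assumes "f \<in> C_0"
  shows "rhmc_semigroup U r \<alpha> t f \<in> C_0"
  unfolding rhmc_semigroup_def[abs_def]
proof (rule C_0_average[OF noise.prob_space_axioms assms])
  show "rhmc_process U \<alpha> z t \<in> borel_measurable noise" for z
    by (rule rhmc_process_measurable)
  show "continuous_on UNIV (\<lambda>z. rhmc_process U \<alpha> z t \<omega>)" for \<omega>
    using post_jump_state_continuous_proper
    by (auto simp: rhmc_process_def Let_def ham_flow_eq intro!: continuous_on_compose2[OF flow_continuous])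
  show "filterlim (\<lambda>z. rhmc_process U \<alpha> z t \<omega>) at_infinity at_infinity" for \<omega>
    using post_jump_state_continuous_proper
    by (auto simp: rhmc_process_def Let_def ham_flow_eq intro!: filterlim_compose[OF flow_filterlim])
qed

lemma semigroup_integrable:
  assumes "f \<in> C_0"
  shows "integrable noise (\<lambda>\<omega>. f (rhmc_process U \<alpha> z t \<omega>))"
proof -
  obtain B where "\<And>z. \<bar>f z\<bar> \<le> B" using C_0_bounded[OF assms] by blast
  moreover have "f \<in> borel_measurable borel"
    using assms by (intro borel_measurable_continuous_onI) (simp add: C_0_def)
  ultimately show ?thesis
    by (intro noise.integrable_const_bound[where B = B]) (auto intro: measurable_compose[OF rhmc_process_measurable])
qed

sublocale contraction_family "rhmc_semigroup U r \<alpha>"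
proof
  fix t :: real and f h :: "'a \<times> 'a \<Rightarrow> real" and B z
  assume "t \<ge> 0" and f: "f \<in> C_0"
  show "rhmc_semigroup U r \<alpha> t f \<in> C_0" by (rule semigroup_C_0[OF f])
  show "\<bar>rhmc_semigroup U r \<alpha> t f z\<bar> \<le> B" if "\<And>z. \<bar>f z\<bar> \<le> B"
  proof -
    have "\<bar>rhmc_semigroup U r \<alpha> t f z\<bar> \<le> (\<integral>\<omega>. \<bar>f (rhmc_process U \<alpha> z t \<omega>)\<bar> \<partial>noise)"
      unfolding rhmc_semigroup_def by (rule integral_abs_bound)
    also have "\<dots> \<le> B"
      using that by (intro noise.integral_le_const integrable_abs semigroup_integrable f) auto
    finally show ?thesis .
  qed
  assume h: "h \<in> C_0"
  show "rhmc_semigroup U r \<alpha> t (\<lambda>z. f z - h z) z = rhmc_semigroup U r \<alpha> t f z - rhmc_semigroup U r \<alpha> t h z"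
    unfolding rhmc_semigroup_def
    by (rule Bochner_Integration.integral_diff) (intro semigroup_integrable f h)+
qed

definition jump_op :: "('a \<times> 'a \<Rightarrow> real) \<Rightarrow> 'a \<times> 'a \<Rightarrow> real" where
  "jump_op f z = (\<integral>\<xi>. f (refresh \<alpha> \<xi> z) \<partial>std_gaussian)"

lemma refreshed_integrable:
  fixes f :: "'a \<times> 'a \<Rightarrow> real"
  assumes "f \<in> C_0"
  shows "integrable std_gaussian (\<lambda>\<xi>. f (refresh \<alpha> \<xi> z))"
proof -
  obtain B where "\<And>z. \<bar>f z\<bar> \<le> B" using C_0_bounded[OF assms] by blast
  moreover have "f \<in> borel_measurable borel"
    using assms by (intro borel_measurable_continuous_onI) (simp add: C_0_def)
  moreover have "(\<lambda>\<xi>. refresh \<alpha> \<xi> z) \<in> borel_measurable std_gaussian"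
    by (rule refresh_measurable) (simp_all add: measurable_cong_sets[OF sets_std_gaussian refl])
  ultimately show ?thesis
    by (intro G.integrable_const_bound[where B = B]) (auto intro: measurable_compose)
qed

lemma jump_op_C_0: "f \<in> C_0 \<Longrightarrow> jump_op f \<in> C_0"
  unfolding jump_op_def
  by (rule C_0_average[OF G.prob_space_axioms])
    (auto intro!: refresh_measurable refresh_continuous refresh_proper
      simp: measurable_cong_sets[OF sets_std_gaussian refl])

lemma jump_op_bound: "f \<in> C_0 \<Longrightarrow> (\<And>z. \<bar>f z\<bar> \<le> B) \<Longrightarrow> \<bar>jump_op f z\<bar> \<le> B"
proof -
  assume f: "f \<in> C_0" "\<And>z. \<bar>f z\<bar> \<le> B"
  have "\<bar>jump_op f z\<bar> \<le> (\<integral>\<xi>. \<bar>f (refresh \<alpha> \<xi> z)\<bar> \<partial>std_gaussian)"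
    unfolding jump_op_def by (rule integral_abs_bound)
  also have "\<dots> \<le> B"
    using f(2) by (intro G.integral_le_const integrable_abs refreshed_integrable f) auto
  finally show ?thesis .
qed

lemma jump_op_add: "f \<in> C_0 \<Longrightarrow> h \<in> C_0 \<Longrightarrow> jump_op (\<lambda>z. f z + h z) z = jump_op f z + jump_op h z"
  unfolding jump_op_def by (rule Bochner_Integration.integral_add) (intro refreshed_integrable; assumption)+

end

section \<open>Small-time expansion and the generator\<close>

context rhmc
begin

definition jump_prob :: "real \<Rightarrow> real" where
  "jump_prob t = 1 - exp (- r * t)"

lemma jump_prob_nonneg: "t \<ge> 0 \<Longrightarrow> jump_prob t \<ge> 0"
  using r_pos by (simp add: jump_prob_def)

lemma jump_prob_le: "jump_prob t \<le> r * t"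
  using exp_ge_add_one_self[of "- r * t"] by (simp add: jump_prob_def)

lemma jump_prob_ge: "t \<ge> 0 \<Longrightarrow> r * t - (r * t)\<^sup>2 \<le> jump_prob t"
proof -
  assume "t \<ge> 0"
  define x where "x = r * t"
  have "x \<ge> 0" using r_pos \<open>t \<ge> 0\<close> by (simp add: x_def)
  have "exp (- x) = 1 / exp x" by (simp add: exp_minus inverse_eq_divide)
  also have "\<dots> \<le> 1 / (1 + x)"
    using exp_ge_add_one_self[of x] \<open>x \<ge> 0\<close> by (intro divide_left_mono) (auto intro: mult_pos_pos)
  also have "\<dots> \<le> 1 - x + x\<^sup>2"
  proof -
    have "(1 - x + x\<^sup>2) * (1 + x) = 1 + x ^ 3"
      by (simp add: algebra_simps power2_eq_square power3_eq_cube)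
    then have "1 \<le> (1 - x + x\<^sup>2) * (1 + x)" using \<open>x \<ge> 0\<close> by simp
    then show ?thesis using \<open>x \<ge> 0\<close> by (simp add: pos_divide_le_eq)
  qed
  finally show ?thesis by (simp add: jump_prob_def x_def)
qed

lemma waiting_time_le: "t \<ge> 0 \<Longrightarrow> W.prob {..t} = jump_prob t"
  using emeasure_erlang_density[OF r_pos, of 0 t] r_pos
  by (simp add: measure_def erlang_CDF_0 jump_prob_def)

lemma jump_noise_le:
  assumes "t \<ge> 0"
  shows "emeasure jump_noise ({..t} \<times> UNIV) = ennreal (jump_prob t)"
proof -
  have "emeasure jump_noise ({..t} \<times> UNIV) = emeasure (waiting_time r) {..t} * emeasure std_gaussian (UNIV :: 'a set)"
    by (rule G.emeasure_pair_measure_Times) auto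
  also have "emeasure std_gaussian (UNIV :: 'a set) = 1" using G.emeasure_space_1 by simp
  also have "emeasure (waiting_time r) {..t} = ennreal (jump_prob t)"
    using waiting_time_le[OF assms] by (simp add: W.emeasure_eq_measure)
  finally show ?thesis by simp
qed

definition early :: "nat \<Rightarrow> real \<Rightarrow> (nat \<Rightarrow> real \<times> 'a) set" where
  "early n t = {\<omega>\<in>space noise. fst (\<omega> n) \<le> t}"

lemma early_measurable [measurable]: "early n t \<in> sets noise"
  unfolding early_def by measurable

lemma prob_early:
  assumes "t \<ge> 0"
  shows "noise.prob (early n t) = jump_prob t"
    and "noise.prob (early 0 t \<inter> early 1 t) = (jump_prob t)\<^sup>2"
proof -
  have sets: "{..t} \<times> (UNIV::'a set) \<in> sets jump_noise"
    by (rule pair_measureI) auto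
  have 1: "emeasure noise {\<omega>\<in>space noise. \<forall>i\<in>J. \<omega> i \<in> {..t} \<times> UNIV} = (\<Prod>i\<in>J. ennreal (jump_prob t))"
    if "finite J" for J
    unfolding noise_eq using that sets
    by (subst N.emeasure_PiM_Collect) (auto simp: jump_noise_le[OF assms])
  have "early n t = {\<omega>\<in>space noise. \<forall>i\<in>{n}. \<omega> i \<in> {..t} \<times> UNIV}"
    by (auto simp: early_def mem_Times_iff)
  with 1[of "{n}"] show "noise.prob (early n t) = jump_prob t"
    using jump_prob_nonneg[OF assms] by (simp add: measure_def)
  have "early 0 t \<inter> early 1 t = {\<omega>\<in>space noise. \<forall>i\<in>{0, 1}. \<omega> i \<in> {..t} \<times> UNIV}"
    by (auto simp: early_def mem_Times_iff)
  with 1[of "{0, 1}"] show "noise.prob (early 0 t \<inter> early 1 t) = (jump_prob t)\<^sup>2"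
    using jump_prob_nonneg[OF assms] by (simp add: measure_def power2_eq_square flip: ennreal_mult)
qed

lemma AE_waiting_time_pos: "AE \<omega> in noise. fst (\<omega> n) > 0"
proof -
  have "noise.prob (early n 0) = 0" using prob_early(1)[of 0 n] by (simp add: jump_prob_def)
  then have "AE \<omega> in noise. \<omega> \<notin> early n 0" by (subst (asm) noise.prob_eq_0) auto
  then show ?thesis by (rule AE_mp) (auto simp: early_def)
qed

lemma process_before_first_jump:
  assumes "t < fst (\<omega> 0)"
  shows "rhmc_process U \<alpha> z t \<omega> = \<phi> t z"
proof -
  have "num_jumps \<omega> t = 0"
    unfolding num_jumps_def using assms by (intro Least_equality) (auto simp: jump_time_def)
  then show ?thesis by (simp add: rhmc_process_def ham_flow_eq jump_time_def)
qed

lemma process_after_one_jump: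
  assumes "fst (\<omega> 0) \<le> t" "t < fst (\<omega> 0) + fst (\<omega> 1)"
  shows "rhmc_process U \<alpha> z t \<omega> =
    \<phi> (t - fst (\<omega> 0)) (refresh \<alpha> (snd (\<omega> 0)) (\<phi> (fst (\<omega> 0)) z))"
proof -
  have "num_jumps \<omega> t = 1"
    unfolding num_jumps_def
  proof (rule Least_equality)
    show "t < jump_time \<omega> (Suc 1)" using assms by (simp add: jump_time_def lessThan_Suc)
    fix n assume "t < jump_time \<omega> (Suc n)"
    then show "1 \<le> n" using assms(1) by (cases n) (auto simp: jump_time_def)
  qed
  then show ?thesis by (simp add: rhmc_process_def ham_flow_eq jump_time_def Let_def)
qed

text \<open>The first waiting time and the first refreshment are independent, so averaging over the
  refreshment alone replaces \<open>f\<close> by \<open>jump_op f\<close>, which the flow up to the jump changes by at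
  most \<open>e\<close>.\<close>

lemma expectation_one_jump:
  fixes z :: "'a \<times> 'a"
  assumes f: "f \<in> C_0" and "t \<ge> 0" "e \<ge> 0" and Qe: "\<And>s z. \<bar>s\<bar> \<le> t \<Longrightarrow> \<bar>jump_op f (\<phi> s z) - jump_op f z\<bar> \<le> e"
  defines "k \<equiv> \<lambda>(s, \<xi>). indicator {..t} s * f (refresh \<alpha> \<xi> (\<phi> s z))"
  shows "integrable noise (\<lambda>\<omega>. k (\<omega> 0))"
    and "\<bar>noise.expectation (\<lambda>\<omega>. k (\<omega> 0)) - jump_prob t * jump_op f z\<bar> \<le> e * jump_prob t"
proof -
  obtain B where B: "B > 0" "\<And>z. \<bar>f z\<bar> \<le> B" using C_0_bounded[OF f] by blast
  have mf: "f \<in> borel_measurable borel"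
    using f by (intro borel_measurable_continuous_onI) (simp add: C_0_def)
  have mQ: "(\<lambda>s. jump_op f (\<phi> s z)) \<in> borel_measurable borel"
    using jump_op_C_0[OF f] flow_measurable[of "\<lambda>s. s" borel "\<lambda>_. z"]
    by (auto intro: measurable_compose borel_measurable_continuous_onI simp: C_0_def)
  have fst_m: "fst \<in> borel_measurable jump_noise" and snd_m: "snd \<in> borel_measurable jump_noise"
    using measurable_fst[of "waiting_time r" "std_gaussian :: 'a measure"]
      measurable_snd[of "waiting_time r" "std_gaussian :: 'a measure"]
    by (simp_all add: measurable_cong_sets[OF refl sets_std_gaussian]
        measurable_cong_sets[OF refl sets_density] )
  have "(\<lambda>x. refresh \<alpha> (snd x) (\<phi> (fst x) z)) \<in> borel_measurable jump_noise"
    by (intro refresh_measurable flow_measurable fst_m snd_m) simp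
  from measurable_compose[OF this mf] have "(\<lambda>x. indicator {..t} (fst x) * f (refresh \<alpha> (snd x) (\<phi> (fst x) z)))
      \<in> borel_measurable jump_noise"
    by (intro borel_measurable_times measurable_compose[OF fst_m]) auto
  then have mk: "k \<in> borel_measurable jump_noise" by (simp add: k_def case_prod_beta')
  have "\<bar>k x\<bar> \<le> B" for x
    using B by (cases x) (auto simp: k_def indicator_def abs_mult less_imp_le)
  then have ik: "integrable jump_noise k"
    by (intro WG.P.integrable_const_bound[where B = B]) (auto intro: mk)
  have distr: "distr noise jump_noise (\<lambda>\<omega>. \<omega> 0) = jump_noise"
    unfolding noise_eq by (rule N.PiM_component) simp
  show "integrable noise (\<lambda>\<omega>. k (\<omega> 0))"
    using integrable_distr[OF noise_component_measurable[of 0], of k] ik distr by simp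
  have "noise.expectation (\<lambda>\<omega>. k (\<omega> 0)) = integral\<^sup>L (distr noise jump_noise (\<lambda>\<omega>. \<omega> 0)) k"
    by (rule integral_distr[symmetric, OF noise_component_measurable mk])
  also have "\<dots> = integral\<^sup>L jump_noise k" by (simp add: distr)
  also have "\<dots> = (\<integral>s. \<integral>\<xi>. k (s, \<xi>) \<partial>std_gaussian \<partial>waiting_time r)"
    by (rule WG.integral_fst'[symmetric, OF ik])
  also have "\<dots> = (\<integral>s. indicator {..t} s * jump_op f (\<phi> s z) \<partial>waiting_time r)"
    by (simp add: k_def jump_op_def)
  finally have Ek: "noise.expectation (\<lambda>\<omega>. k (\<omega> 0)) = (\<integral>s. indicator {..t} s * jump_op f (\<phi> s z) \<partial>waiting_time r)" .
  have iQ: "integrable (waiting_time r) (\<lambda>s. indicator {..t} s * jump_op f (\<phi> s z))"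
    using jump_op_bound[OF f B(2)] mQ
    by (intro W.integrable_const_bound[where B = B]) (auto simp: indicator_def intro!: AE_I2 less_imp_le[OF B(1)])
  have ii: "integrable (waiting_time r) (indicator {..t} :: real \<Rightarrow> real)"
    by (intro W.integrable_const_bound[where B = 1]) (auto simp: indicator_def)
  have pos: "AE s in waiting_time r. s > 0"
  proof -
    have "W.prob {..0} = 0" using waiting_time_le[of 0] by (simp add: jump_prob_def)
    then have "AE s in waiting_time r. s \<notin> {..0}" by (subst (asm) W.prob_eq_0) auto
    then show ?thesis by (rule AE_mp) auto
  qed
  have "\<bar>noise.expectation (\<lambda>\<omega>. k (\<omega> 0)) - jump_prob t * jump_op f z\<bar> =
      \<bar>\<integral>s. indicator {..t} s * jump_op f (\<phi> s z) - indicator {..t} s * jump_op f z \<partial>waiting_time r\<bar>"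
    using iQ ii waiting_time_le[OF \<open>t \<ge> 0\<close>] by (simp add: Ek)
  also have "\<dots> \<le> (\<integral>s. \<bar>indicator {..t} s * jump_op f (\<phi> s z) - indicator {..t} s * jump_op f z\<bar> \<partial>waiting_time r)"
    by (rule integral_abs_bound)
  also have "\<dots> \<le> (\<integral>s. e * indicator {..t} s \<partial>waiting_time r)"
  proof (rule integral_mono_AE)
    show "AE s in waiting_time r. \<bar>indicator {..t} s * jump_op f (\<phi> s z) - indicator {..t} s * jump_op f z\<bar> \<le> e * indicator {..t} s"
      using pos by eventually_elim (auto simp: indicator_def intro!: Qe)
  qed (use iQ ii in auto)
  also have "\<dots> = e * jump_prob t" using waiting_time_le[OF \<open>t \<ge> 0\<close>] by simp
  finally show "\<bar>noise.expectation (\<lambda>\<omega>. k (\<omega> 0)) - jump_prob t * jump_op f z\<bar> \<le> e * jump_prob t" .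
qed

text \<open>Two jumps before time \<open>t\<close> have probability \<open>O (t\<^sup>2)\<close>. With at most one jump, moving the point
  along the flow before and after it changes \<open>jump_op f\<close> and \<open>f\<close> only by the modulus of continuity \<open>e\<close>
  of the transport.\<close>

lemma one_jump_expansion:
  assumes f: "f \<in> C_0" and B: "\<And>z. \<bar>f z\<bar> \<le> B" and "t \<ge> 0" "e \<ge> 0"
    and fe: "\<And>s z. \<bar>s\<bar> \<le> t \<Longrightarrow> \<bar>f (\<phi> s z) - f z\<bar> \<le> e"
    and Qe: "\<And>s z. \<bar>s\<bar> \<le> t \<Longrightarrow> \<bar>jump_op f (\<phi> s z) - jump_op f z\<bar> \<le> e"
  shows "\<bar>rhmc_semigroup U r \<alpha> t f z - ((1 - jump_prob t) * f (\<phi> t z) + jump_prob t * jump_op f z)\<bar>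
    \<le> 2 * e * jump_prob t + 2 * B * (jump_prob t)\<^sup>2"
proof -
  let ?p = "jump_prob t"
  let ?A = "early 0 t" let ?A2 = "early 0 t \<inter> early 1 t"
  define k where "k = (\<lambda>(s, \<xi>). indicator {..t} s * f (refresh \<alpha> \<xi> (\<phi> s z)))"
  note k = expectation_one_jump[OF f \<open>t \<ge> 0\<close> \<open>e \<ge> 0\<close> Qe, of z, folded k_def]
  let ?X = "\<lambda>\<omega>. f (rhmc_process U \<alpha> z t \<omega>)"
  let ?Y = "\<lambda>\<omega>. (1 - indicator ?A \<omega>) * f (\<phi> t z) + k (\<omega> 0)"
  have iA: "integrable noise (indicator ?A :: _ \<Rightarrow> real)" "integrable noise (indicator ?A2 :: _ \<Rightarrow> real)"
    by (auto intro!: noise.integrable_const_bound[where B = 1] simp: indicator_def)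
  have EA: "noise.expectation (indicator ?A) = ?p" "noise.expectation (indicator ?A2) = ?p\<^sup>2"
    using prob_early[OF \<open>t \<ge> 0\<close>] by simp_all
  have iY: "integrable noise ?Y" using iA k(1) by (intro Bochner_Integration.integrable_add) auto
  have EY: "noise.expectation ?Y = (1 - ?p) * f (\<phi> t z) + noise.expectation (\<lambda>\<omega>. k (\<omega> 0))"
    using iA k(1) EA by (simp add: noise.prob_space)
  have le: "AE \<omega> in noise. \<bar>?X \<omega> - ?Y \<omega>\<bar> \<le> e * indicator ?A \<omega> + 2 * B * indicator ?A2 \<omega>"
    using AE_waiting_time_pos[of 0] AE_waiting_time_pos[of 1] AE_space
  proof eventually_elim
    fix \<omega> assume \<omega>: "fst (\<omega> 0) > 0" "fst (\<omega> 1) > 0" "\<omega> \<in> space noise"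
    let ?w = "refresh \<alpha> (snd (\<omega> 0)) (\<phi> (fst (\<omega> 0)) z)"
    have kw: "k (\<omega> 0) = (if fst (\<omega> 0) \<le> t then f ?w else 0)"
      by (simp add: k_def case_prod_beta indicator_def)
    consider "t < fst (\<omega> 0)" | "fst (\<omega> 0) \<le> t" "t < fst (\<omega> 1)" | "fst (\<omega> 0) \<le> t" "fst (\<omega> 1) \<le> t"
      by linarith
    then show "\<bar>?X \<omega> - ?Y \<omega>\<bar> \<le> e * indicator ?A \<omega> + 2 * B * indicator ?A2 \<omega>"
    proof cases
      case 1
      then show ?thesis by (simp add: process_before_first_jump kw early_def)
    next
      case 2
      then have "\<bar>f (\<phi> (t - fst (\<omega> 0)) ?w) - f ?w\<bar> \<le> e" using \<omega> by (intro fe) auto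
      then show ?thesis using 2 \<omega> by (simp add: process_after_one_jump kw early_def)
    next
      case 3
      have "\<bar>?X \<omega> - f ?w\<bar> \<le> 2 * B" using B[of "rhmc_process U \<alpha> z t \<omega>"] B[of ?w] by linarith
      then show ?thesis using 3 \<omega> \<open>e \<ge> 0\<close> by (simp add: kw early_def)
    qed
  qed
  have "\<bar>noise.expectation ?X - noise.expectation ?Y\<bar> = \<bar>noise.expectation (\<lambda>\<omega>. ?X \<omega> - ?Y \<omega>)\<bar>"
    using semigroup_integrable[OF f] iY by simp
  also have "\<dots> \<le> noise.expectation (\<lambda>\<omega>. \<bar>?X \<omega> - ?Y \<omega>\<bar>)" by (rule integral_abs_bound)
  also have "\<dots> \<le> noise.expectation (\<lambda>\<omega>. e * indicator ?A \<omega> + 2 * B * indicator ?A2 \<omega>)"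
    using iA iY semigroup_integrable[OF f]
    by (intro integral_mono_AE le integrable_abs Bochner_Integration.integrable_diff) auto
  also have "\<dots> = e * ?p + 2 * B * ?p\<^sup>2" using iA EA by simp
  finally have "\<bar>noise.expectation ?X - noise.expectation ?Y\<bar> \<le> e * ?p + 2 * B * ?p\<^sup>2" .
  then show ?thesis using k(2) unfolding EY rhmc_semigroup_def by linarith
qed

lemma semigroup_strongly_continuous:
  assumes f: "f \<in> C_0"
  shows "((\<lambda>t. sup_norm (\<lambda>z. rhmc_semigroup U r \<alpha> t f z - f z)) \<longlongrightarrow> 0) (at_right 0)"
proof (rule sup_norm_at_right_zeroI)
  fix \<eta> :: real assume "\<eta> > 0"
  obtain B where B: "B > 0" "\<And>z. \<bar>f z\<bar> \<le> B" using C_0_bounded[OF f] by blast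
  define e where "e = \<eta> / 6"
  have e: "e > 0" using \<open>\<eta> > 0\<close> by (simp add: e_def)
  obtain d1 where d1: "d1 > 0" "\<And>t z. \<bar>t\<bar> \<le> d1 \<Longrightarrow> \<bar>f (\<phi> t z) - f z\<bar> \<le> e"
    using transport_strongly_continuous[OF f e] by blast
  obtain d2 where d2: "d2 > 0" "\<And>t z. \<bar>t\<bar> \<le> d2 \<Longrightarrow> \<bar>jump_op f (\<phi> t z) - jump_op f z\<bar> \<le> e"
    using transport_strongly_continuous[OF jump_op_C_0[OF f] e] by blast
  define d where "d = min (min d1 d2) (\<eta> / (8 * B * r))"
  have d: "d > 0" "d \<le> d1" "d \<le> d2" "d \<le> \<eta> / (8 * B * r)"
    using d1(1) d2(1) \<open>\<eta> > 0\<close> B(1) r_pos by (auto simp: d_def)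
  have "\<bar>rhmc_semigroup U r \<alpha> t f z - f z\<bar> \<le> \<eta>" if t: "0 < t" "t \<le> d" for t z
  proof -
    let ?p = "jump_prob t"
    have p: "0 \<le> ?p" "?p \<le> 1" "?p \<le> r * t"
      using jump_prob_nonneg[of t] jump_prob_le[of t] t by (auto simp: jump_prob_def)
    have "r * t \<le> r * (\<eta> / (8 * B * r))" using t d r_pos by (intro mult_left_mono) auto
    then have "4 * B * ?p \<le> 4 * B * (r * (\<eta> / (8 * B * r)))" using p B(1) by (intro mult_left_mono) auto
    also have "\<dots> = \<eta> / 2" using B(1) r_pos by simp
    finally have Bp: "4 * B * ?p \<le> \<eta> / 2" .
    let ?E = "(1 - ?p) * f (\<phi> t z) + ?p * jump_op f z"
    have "\<bar>rhmc_semigroup U r \<alpha> t f z - ?E\<bar> \<le> 2 * e * ?p + 2 * B * ?p\<^sup>2"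
      using t d d1 d2 e by (intro one_jump_expansion f B) auto
    moreover have "2 * e * ?p \<le> 2 * e" using p e by (simp add: mult_left_le)
    moreover have "2 * B * ?p\<^sup>2 \<le> 2 * B * ?p"
      using p B(1) by (simp add: power2_eq_square mult_left_le)
    ultimately have 1: "\<bar>rhmc_semigroup U r \<alpha> t f z - ?E\<bar> \<le> 2 * e + 2 * B * ?p" by linarith
    have "?E - f z = (f (\<phi> t z) - f z) + ?p * (jump_op f z - f (\<phi> t z))"
      by (simp add: algebra_simps)
    moreover have "\<bar>f (\<phi> t z) - f z\<bar> \<le> e" using t d by (intro d1) auto
    moreover have "\<bar>?p * (jump_op f z - f (\<phi> t z))\<bar> \<le> 2 * B * ?p"
    proof -
      have "\<bar>jump_op f z - f (\<phi> t z)\<bar> \<le> 2 * B"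
        using jump_op_bound[OF f B(2), of z] B(2)[of "\<phi> t z"] by linarith
      then show ?thesis using p by (subst mult.commute) (simp add: abs_mult mult_right_mono)
    qed
    ultimately have "\<bar>?E - f z\<bar> \<le> e + 2 * B * ?p" by linarith
    with 1 have "\<bar>rhmc_semigroup U r \<alpha> t f z - f z\<bar> \<le> 3 * e + 4 * B * ?p" by linarith
    with Bp show ?thesis by (simp add: e_def)
  qed
  then show "\<exists>d>0. \<forall>t z. 0 < t \<and> t \<le> d \<longrightarrow> \<bar>rhmc_semigroup U r \<alpha> t f z - f z\<bar> \<le> \<eta>"
    using d(1) by blast
qed

definition rhmc_generator :: "('a \<times> 'a \<Rightarrow> real) \<Rightarrow> 'a \<times> 'a \<Rightarrow> real" where
  "rhmc_generator f z = lie_derivative (ham_field U) f z + r * (jump_op f z - f z)"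

lemma rhmc_generator_C_0: "f \<in> Cc_infty \<Longrightarrow> rhmc_generator f \<in> C_0"
  unfolding rhmc_generator_def
  by (intro C_0_add C_0_scale C_0_diff lie_derivative_C_0 jump_op_C_0 Cc_infty_in_C_0 field_continuous)

text \<open>The jump probability is \<open>r t + O (t\<^sup>2)\<close>. In the one-jump expansion divided by \<open>t\<close>, the flow
  term gives the derivative along the flow, the jump term gives \<open>r (jump_op f - f)\<close>, and what
  remains is \<open>O (e + t)\<close>.\<close>

lemma rhmc_generator_is_generator_limit:
  assumes f: "f \<in> Cc_infty"
  shows "is_generator_limit (rhmc_semigroup U r \<alpha>) f (rhmc_generator f)"
  unfolding is_generator_limit_def
proof (intro conjI rhmc_generator_C_0 f sup_norm_at_right_zeroI)
  fix \<eta> :: real assume "\<eta> > 0"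
  let ?A = "lie_derivative (ham_field U) f"
  have f0: "f \<in> C_0" by (rule Cc_infty_in_C_0[OF f])
  have A0: "?A \<in> C_0" by (rule lie_derivative_C_0[OF f field_continuous])
  obtain B where B: "B > 0" "\<And>z. \<bar>f z\<bar> \<le> B" using C_0_bounded[OF f0] by blast
  obtain C where C: "C > 0" "\<And>z. \<bar>?A z\<bar> \<le> C" using C_0_bounded[OF A0] by blast
  \<comment> \<open>The error will come out as \<open>e (1 + 2 r) + t K\<close> with the constant \<open>K\<close> below.\<close>
  define e where "e = \<eta> / (2 * (1 + 2 * r))"
  have e: "e > 0" "e * (1 + 2 * r) = \<eta> / 2"
    using \<open>\<eta> > 0\<close> r_pos by (auto simp: e_def field_simps)
  obtain d1 where d1: "d1 > 0" "\<And>t z. \<bar>t\<bar> \<le> d1 \<Longrightarrow> \<bar>f (\<phi> t z) - f z\<bar> \<le> e"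
    using transport_strongly_continuous[OF f0 e(1)] by blast
  obtain d2 where d2: "d2 > 0" "\<And>t z. \<bar>t\<bar> \<le> d2 \<Longrightarrow> \<bar>jump_op f (\<phi> t z) - jump_op f z\<bar> \<le> e"
    using transport_strongly_continuous[OF jump_op_C_0[OF f0] e(1)] by blast
  obtain d3 where d3: "d3 > 0" "\<And>t z. 0 < t \<Longrightarrow> t \<le> d3 \<Longrightarrow> \<bar>(1 / t) * (f (\<phi> t z) - f z) - ?A z\<bar> \<le> e"
    using orbit_difference_quotient[OF A0 test_function_orbit_derivative[OF f] e(1)] by blast
  define K where "K = r * (C + e) + 4 * B * r\<^sup>2"
  have K: "K > 0" using r_pos C(1) e(1) B(1) by (auto simp: K_def intro!: add_pos_pos)
  define d where "d = min (min d1 d2) (min d3 (\<eta> / (2 * K)))"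
  have d: "d > 0" "d \<le> d1" "d \<le> d2" "d \<le> d3" "d \<le> \<eta> / (2 * K)"
    using d1(1) d2(1) d3(1) \<open>\<eta> > 0\<close> K by (auto simp: d_def)
  have "\<bar>(1 / t) * (rhmc_semigroup U r \<alpha> t f z - f z) - rhmc_generator f z\<bar> \<le> \<eta>" if t: "0 < t" "t \<le> d" for t z
  proof -
    define p where "p = jump_prob t"
    define D where "D = (1 / t) * (f (\<phi> t z) - f z)"
    define err where "err = rhmc_semigroup U r \<alpha> t f z - ((1 - p) * f (\<phi> t z) + p * jump_op f z)"
    have p: "0 \<le> p" "p \<le> r * t" "r * t - (r * t)\<^sup>2 \<le> p"
      using jump_prob_nonneg[of t] jump_prob_le[of t] jump_prob_ge[of t] t by (auto simp: p_def)
    have split: "(1 / t) * (rhmc_semigroup U r \<alpha> t f z - f z) - rhmc_generator f z =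
        (D - ?A z) - p * D + (p / t - r) * (jump_op f z - f z) + err / t"
      using t by (simp add: D_def err_def rhmc_generator_def field_simps)
    have 1: "\<bar>D - ?A z\<bar> \<le> e" unfolding D_def using t d by (intro d3) auto
    have 2: "\<bar>p * D\<bar> \<le> t * (r * (C + e))"
    proof -
      have "\<bar>D\<bar> \<le> C + e" using 1 C(2)[of z] by linarith
      then have "\<bar>p\<bar> * \<bar>D\<bar> \<le> (r * t) * (C + e)" using p by (intro mult_mono) auto
      then show ?thesis by (simp add: abs_mult mult.commute mult.left_commute)
    qed
    have 3: "\<bar>(p / t - r) * (jump_op f z - f z)\<bar> \<le> t * (2 * B * r\<^sup>2)"
    proof -
      have "\<bar>p / t - r\<bar> \<le> r\<^sup>2 * t"
        using p t by (simp add: abs_le_iff field_simps power2_eq_square)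
      moreover have "\<bar>jump_op f z - f z\<bar> \<le> 2 * B"
        using jump_op_bound[OF f0 B(2), of z] B(2)[of z] by linarith
      ultimately have "\<bar>p / t - r\<bar> * \<bar>jump_op f z - f z\<bar> \<le> (r\<^sup>2 * t) * (2 * B)"
        using t by (intro mult_mono) auto
      then show ?thesis by (simp add: abs_mult mult.commute mult.left_commute)
    qed
    have 4: "\<bar>err / t\<bar> \<le> 2 * e * r + t * (2 * B * r\<^sup>2)"
    proof -
      have "\<bar>err\<bar> \<le> 2 * e * p + 2 * B * p\<^sup>2"
        unfolding err_def p_def using t d d1 d2 e by (intro one_jump_expansion f0 B) auto
      also have "\<dots> \<le> 2 * e * (r * t) + 2 * B * (r * t)\<^sup>2"
        using p e B(1) by (intro add_mono mult_left_mono power_mono) auto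
      finally have "\<bar>err\<bar> / t \<le> (2 * e * (r * t) + 2 * B * (r * t)\<^sup>2) / t"
        using t by (intro divide_right_mono) auto
      also have "\<dots> = 2 * e * r + t * (2 * B * r\<^sup>2)" using t by (simp add: field_simps power2_eq_square)
      finally show ?thesis using t by simp
    qed
    have "\<bar>(1 / t) * (rhmc_semigroup U r \<alpha> t f z - f z) - rhmc_generator f z\<bar> \<le>
        e + t * (r * (C + e)) + t * (2 * B * r\<^sup>2) + (2 * e * r + t * (2 * B * r\<^sup>2))"
      unfolding split using 1 2 3 4 by linarith
    also have "\<dots> = e * (1 + 2 * r) + t * K" by (simp add: K_def algebra_simps)
    also have "t * K \<le> \<eta> / (2 * K) * K" using t d K by (intro mult_right_mono) auto
    also have "\<eta> / (2 * K) * K = \<eta> / 2" using K by simp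
    finally show ?thesis using e(2) by simp
  qed
  then show "\<exists>d>0. \<forall>t z. 0 < t \<and> t \<le> d \<longrightarrow>
      \<bar>(1 / t) * (rhmc_semigroup U r \<alpha> t f z - f z) - rhmc_generator f z\<bar> \<le> \<eta>"
    using d(1) by blast
qed

text \<open>For \<open>F\<close> from the resolvent equation of the flow with \<open>\<nu> = L + r\<close>, the residual of
  \<open>L F - rhmc_generator F = h\<close> is the jump term \<open>r jump_op F\<close> up to a small error, and its norm is at most
  about \<open>r / \<nu>\<close> times that of \<open>h\<close>.\<close>

lemma generator_residual:
  assumes confined: "\<And>R. \<exists>S. \<forall>z t. norm z > S \<longrightarrow> norm (\<phi> t z) > R"
    and h: "h \<in> C_0" and "B > 0" "\<And>z. \<bar>h z\<bar> \<le> B"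
  shows "\<exists>F\<in>Cc_infty. \<forall>z. \<bar>(L * F z - rhmc_generator F z) - h z\<bar> \<le> (r + L / 2) / (L + r) * B"
proof -
  define \<nu> where "\<nu> = L + r"
  \<comment> \<open>Small enough for \<open>c \<nu> + c r\<close> to stay below \<open>L / 2\<close>.\<close>
  define c where "c = L / (4 * \<nu>)"
  have \<nu>: "\<nu> > L" "\<nu> > 0" using L_pos r_pos by (auto simp: \<nu>_def)
  have c: "c > 0" "c * \<nu> = L / 4" using L_pos \<nu> by (auto simp: c_def)
  have "c * B > 0" using c \<open>B > 0\<close> by simp
  from resolvent_equation_approx[OF confined \<nu>(1) h assms(4) this]
  obtain F where F: "F \<in> Cc_infty"
    "\<And>z. \<bar>\<nu> * F z - lie_derivative (ham_field U) F z - h z\<bar> \<le> c * B"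
    "\<And>z. \<bar>F z\<bar> \<le> (B + c * B) / \<nu>"
    by blast
  have "\<bar>(L * F z - rhmc_generator F z) - h z\<bar> \<le> (r + L / 2) / (L + r) * B" for z
  proof -
    have "\<bar>jump_op F z\<bar> \<le> (B + c * B) / \<nu>" by (rule jump_op_bound[OF Cc_infty_in_C_0[OF F(1)] F(3)])
    then have "\<bar>r * jump_op F z\<bar> \<le> r * ((B + c * B) / \<nu>)" using r_pos
      unfolding abs_mult by (intro mult_mono) auto
    moreover have "(L * F z - rhmc_generator F z) - h z =
        (\<nu> * F z - lie_derivative (ham_field U) F z - h z) - r * jump_op F z"
      by (simp add: rhmc_generator_def \<nu>_def algebra_simps)
    ultimately have "\<bar>(L * F z - rhmc_generator F z) - h z\<bar> \<le> c * B + r * ((B + c * B) / \<nu>)"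
      using F(2)[of z] by linarith
    also have "\<dots> = (c * \<nu> + r + c * r) / \<nu> * B" using \<nu> by (simp add: field_simps)
    also have "\<dots> \<le> (r + L / 2) / \<nu> * B"
    proof (intro mult_right_mono divide_right_mono)
      have "c * r \<le> c * \<nu>" using c \<nu>_def L_pos by (intro mult_left_mono) auto
      then show "c * \<nu> + r + c * r \<le> r + L / 2" using c(2) by simp
    qed (use \<nu> \<open>B > 0\<close> in auto)
    finally show ?thesis by (simp add: \<nu>_def)
  qed
  then show ?thesis using F(1) by blast
qed

theorem feller_and_core:
  assumes confined: "\<And>R. \<exists>S. \<forall>z t. norm z > S \<longrightarrow> norm (\<phi> t z) > R"
  shows "feller (rhmc_semigroup U r \<alpha>) \<and> is_core_of_generator Cc_infty (rhmc_semigroup U r \<alpha>)"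
proof
  show "feller (rhmc_semigroup U r \<alpha>)"
    unfolding feller_def using preserves_C_0 semigroup_strongly_continuous by blast
  show "is_core_of_generator Cc_infty (rhmc_semigroup U r \<alpha>)"
  proof (rule core_if_dense_range[where A = rhmc_generator, OF _ rhmc_generator_is_generator_limit L_pos])
    show "Cc_infty \<subseteq> C_0" using Cc_infty_in_C_0 by blast
    fix h :: "'a \<times> 'a \<Rightarrow> real" and e :: real assume h: "h \<in> C_0" "e > 0"
    show "\<exists>F\<in>Cc_infty. \<forall>z. \<bar>L * F z - rhmc_generator F z - h z\<bar> \<le> e"
    proof (rule dense_range_if_residual_shrinks[where T = "\<lambda>F z. L * F z - rhmc_generator F z" and \<theta> = "(r + L / 2) / (L + r)"])
      show "(\<lambda>z. L * F z - rhmc_generator F z) \<in> C_0" if "F \<in> Cc_infty" for F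
        using that by (intro C_0_diff C_0_scale rhmc_generator_C_0 Cc_infty_in_C_0)
      show "L * (F z + G z) - rhmc_generator (\<lambda>z. F z + G z) z = (L * F z - rhmc_generator F z) + (L * G z - rhmc_generator G z)"
        if "F \<in> Cc_infty" "G \<in> Cc_infty" for F G z
        using that by (simp add: rhmc_generator_def lie_derivative_add jump_op_add Cc_infty_in_C_0 algebra_simps)
      show "0 < (r + L / 2) / (L + r)" "(r + L / 2) / (L + r) < 1" using L_pos r_pos by auto
    qed (use generator_residual[OF confined] Cc_infty_add h in auto)
  qed
qed

end

section \<open>Conservation of energy\<close>

lemma gderiv_grad:
  assumes "U differentiable (at q)"
  shows "GDERIV U q :> grad U q"
proof -
  have "(U has_derivative frechet_derivative U (at q)) (at q)"
    using assms by (simp add: frechet_derivative_works)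
  then have "linear (frechet_derivative U (at q))" by (rule has_derivative_linear)
  then have "\<exists>D. frechet_derivative U (at q) = (\<lambda>h. h \<bullet> D)"
    by (intro exI[of _ "adjoint (frechet_derivative U (at q)) 1"]) (simp add: adjoint_works fun_eq_iff inner_real_def)
  then obtain D where "GDERIV U q :> D"
    using \<open>(U has_derivative frechet_derivative U (at q)) (at q)\<close> by (auto simp: gderiv_def)
  moreover have "D' = D" if "GDERIV U q :> D'" for D'
  proof -
    have "(\<lambda>h. h \<bullet> D') = (\<lambda>h. h \<bullet> D)"
      using that \<open>GDERIV U q :> D\<close> by (auto simp: gderiv_def dest: has_derivative_unique)
    then show ?thesis by (metis vector_eq_ldot)
  qed
  ultimately show ?thesis unfolding grad_def by (rule theI)
qed

text \<open>The energy \<open>U q + \<bar>p\<bar>\<^sup>2 / 2\<close> is constant along orbits and, as \<open>U\<close> is nonnegative and tends to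
  infinity, its sublevel sets are bounded.\<close>

lemma ham_flow_confined:
  fixes U :: "'a::euclidean_space \<Rightarrow> real"
  assumes "lipschitz_field (ham_field U) L" and dU: "\<And>q. U differentiable (at q)"
    and nonneg: "\<And>q. U q \<ge> 0" and proper: "filterlim U at_top at_infinity"
  shows "\<exists>S. \<forall>z t. norm z > S \<longrightarrow> norm (flow_of (ham_field U) t z) > R"
proof -
  interpret lipschitz_field "ham_field U" L by fact
  define H :: "'a \<times> 'a \<Rightarrow> real" where "H z = U (fst z) + 1 / 2 * (snd z \<bullet> snd z)" for z
  have conserved: "H (\<phi> t z) = H z" for t z
  proof -
    have "((\<lambda>t. H (\<phi> t z)) has_real_derivative 0) (at s)" for s
    proof -
      let ?q = "fst (\<phi> s z)" and ?p = "snd (\<phi> s z)"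
      have d: "((\<lambda>s. \<phi> s z) has_derivative (\<lambda>h. h *\<^sub>R (?p, - grad U ?q))) (at s)"
        using flow_is_solution(2)[of z s]
        by (simp add: has_vector_derivative_def ham_field_def case_prod_beta)
      have q: "((\<lambda>s. fst (\<phi> s z)) has_derivative (\<lambda>h. h *\<^sub>R ?p)) (at s)"
        and p: "((\<lambda>s. snd (\<phi> s z)) has_derivative (\<lambda>h. h *\<^sub>R (- grad U ?q))) (at s)"
        using has_derivative_fst[OF d] has_derivative_snd[OF d] by auto
      have "(U has_derivative (\<lambda>h. h \<bullet> grad U ?q)) (at ?q)"
        using gderiv_grad[OF dU] by (simp add: gderiv_def)
      from has_derivative_compose[OF q this]
      have "((\<lambda>s. U (fst (\<phi> s z))) has_derivative (\<lambda>h. (h *\<^sub>R ?p) \<bullet> grad U ?q)) (at s)" .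
      from has_derivative_add[OF this has_derivative_mult_right[OF has_derivative_inner[OF p p], of "1 / 2"]]
      show ?thesis
        unfolding H_def by (rule has_derivative_imp_has_field_derivative) (auto simp: inner_commute)
    qed
    then have "H (\<phi> t z) = H (\<phi> 0 z)" by (intro DERIV_isconst_all) auto
    then show ?thesis by (simp add: flow_is_solution)
  qed
  have "continuous_on UNIV U" using dU by (simp add: differentiable_imp_continuous_on differentiable_on_def)
  then have cH: "continuous_on UNIV H"
    unfolding H_def by (auto intro!: continuous_intros continuous_on_compose2[of UNIV U])
  have "compact (H ` cball 0 R)"
    using cH by (intro compact_continuous_image) (auto intro: continuous_on_subset)
  then obtain E where E: "\<And>z. norm z \<le> R \<Longrightarrow> H z \<le> E"
    by (force dest!: compact_imp_bounded simp: bounded_iff abs_le_iff)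
  have "eventually (\<lambda>q. U q > E) at_infinity" using proper by (simp add: filterlim_at_top_dense)
  then obtain b where b: "\<And>q. norm q \<ge> b \<Longrightarrow> U q > E" by (auto simp: eventually_at_infinity)
  have "norm (\<phi> t z) > R" if z: "norm z > b + sqrt (2 * E)" for z t
  proof (rule ccontr)
    assume "\<not> ?thesis"
    then have HE: "H z \<le> E" using E[of "\<phi> t z"] conserved[of t z] by simp
    have "U (fst z) \<le> E" using HE inner_ge_zero[of "snd z"] unfolding H_def by linarith
    then have 1: "norm (fst z) < b" using b[of "fst z"] by force
    have "(norm (snd z))\<^sup>2 \<le> 2 * E"
      using HE nonneg[of "fst z"] by (simp add: H_def dot_square_norm)
    then have "norm (snd z) \<le> sqrt (2 * E)" by (simp add: real_le_rsqrt)
    moreover have "norm z \<le> norm (fst z) + norm (snd z)"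
      using norm_Pair_le[of "fst z" "snd z"] by simp
    ultimately show False using 1 z by linarith
  qed
  then show ?thesis by blast
qed

lemma ham_field_lipschitz:
  fixes U :: "'a::euclidean_space \<Rightarrow> real"
  assumes "M-lipschitz_on UNIV (grad U)"
  shows "lipschitz_field (ham_field U) (M + 1)"
proof
  have M: "M \<ge> 0" using assms by (rule lipschitz_on_nonneg)
  then show "M + 1 > 0" by simp
  fix x y :: "'a \<times> 'a"
  have "norm (ham_field U x - ham_field U y) \<le> norm (snd x - snd y) + norm (grad U (fst x) - grad U (fst y))"
    using norm_Pair_le[of "snd x - snd y" "- (grad U (fst x) - grad U (fst y))"]
    by (simp add: ham_field_def case_prod_beta norm_minus_commute)
  also have "\<dots> \<le> norm (x - y) + M * norm (x - y)"
  proof (rule add_mono)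
    show "norm (snd x - snd y) \<le> norm (x - y)" 
      using norm_snd_le[of "snd x - snd y" "fst x - fst y"] by (simp add: minus_prod_def)
    have "norm (grad U (fst x) - grad U (fst y)) \<le> M * norm (fst x - fst y)"
      using lipschitz_onD[OF assms] by (simp add: dist_norm)
    also have "\<dots> \<le> M * norm (x - y)" 
      using M norm_fst_le[of "fst x - fst y" "snd x - snd y"]
      by (intro mult_left_mono) (auto simp: minus_prod_def)
    finally show "norm (grad U (fst x) - grad U (fst y)) \<le> M * norm (x - y)" .
  qed
  finally show "norm (ham_field U x - ham_field U y) \<le> (M + 1) * norm (x - y)"
    by (simp add: algebra_simps)
qed

section \<open>The Feller property and the core\<close>

theorem corollary6p1:
  fixes U :: "real ^ 'd \<Rightarrow> real" and lam_ref \<alpha> :: real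
  assumes "C_k 2 U"
    and "\<And>q. U q \<ge> 0"
    and "integrable lborel (\<lambda>q. exp (- U q))"
    and "lam_ref > 0"
    and "0 < \<alpha>" and "\<alpha> \<le> 1"
    and "\<exists>L. L-lipschitz_on UNIV (grad U)"
    and "filterlim U at_top at_infinity"
  shows "feller (rhmc_semigroup U lam_ref \<alpha>) \<and>
         is_core_of_generator Cc_infty (rhmc_semigroup U lam_ref \<alpha>)"
proof -
  obtain M where M: "M-lipschitz_on UNIV (grad U)" using assms(7) by blast
  have field: "lipschitz_field (ham_field U) (M + 1)" by (rule ham_field_lipschitz[OF M])
  interpret rhmc U "M + 1" lam_ref \<alpha>
    using field assms(4,5) by (simp add: rhmc_def rhmc_axioms_def)
  have dU: "U differentiable (at q)" for q
    using assms(1) by (simp add: numeral_2_eq_2)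
  show ?thesis
    by (rule feller_and_core) (rule ham_flow_confined[OF field dU assms(2,8)])
qed

end
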